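(* Let $(G,g)$ be a connected, simply connected three-dimensional Lie group with a left-invariant Lorentzian metric of Type Ia, i.e. its Lie algebra admits an orthonormal basis $\{e_1,e_2,e_3\}$ of signature $(++-)$ with $$[e_1,e_2]=-\gamma e_3,\quad [e_1,e_3]=-\beta e_2,\quad [e_2,e_3]=\alpha e_1$$ for some $\alpha,\beta,\gamma\in\mathbb{R}$. If there exist a left-invariant vector field $X$ on $G$ and $\lambda\in\mathbb{R}$ with $\mathcal{L}_Xg+C=\lambda g$, then $C=0$ (the left-invariant Cotton soliton is trivial).
   Context: Let $\nabla$ be the Levi-Civita connection of a three-dimensional pseudo-Riemannian manifold, $R(X,Y)=\nabla_{[X,Y]}-[\nabla_X,\nabla_Y]$, Ricci tensor $\rho(X,Y)=\operatorname{trace}\{Z\mapsto R(X,Z)Y\}$, scalar curvature $\tau$, Schouten tensor $S=\rho-\frac{\tau}{4}g$. The $(0,3)$-Cotton tensor is $C_{ijk}=(\nabla_iS)_{jk}-(\nabla_jS)_{ik}$, and the $(0,2)$-Cotton tensor is $C_{ij}=\frac{1}{2\sqrt{|\det g|}}C_{nmi}\,\epsilon^{nm\ell}g_{\ell j}$, where $\epsilon^{ijk}$ is the Levi-Civita symbol with $\epsilon^{123}=1$; here the orientation is the one for which $\{e_1,e_2,e_3\}$ is positively oriented. Signature $(++-)$ means $g(e_1,e_1)=g(e_2,e_2)=-g(e_3,e_3)=1$. A Cotton soliton is a vector field $X$ satisfying $\mathcal{L}_Xg+C=\lambda g$ for some $\lambda\in\mathbb{R}$; it is called trivial if $C=0$.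 *)

theory Defs
  imports "HOL-Analysis.Analysis"
begin

text \<open>
  Three-dimensional pseudo-Riemannian geometry on a manifold whose points are the elements of a
  type.  A chart is a pair \<open>(U, \<phi>)\<close>; the values of \<open>\<phi>\<close> outside \<open>U\<close> are irrelevant.
\<close>

subsection \<open>Smooth maps and smooth structures\<close>

fun Ck_on :: "nat \<Rightarrow> 'a::real_normed_vector set \<Rightarrow> ('a \<Rightarrow> 'b::real_normed_vector) \<Rightarrow> bool" where
  "Ck_on 0 S f \<longleftrightarrow> continuous_on S f"
| "Ck_on (Suc k) S f \<longleftrightarrow>
     (\<forall>x\<in>S. f differentiable (at x)) \<and> (\<forall>v. Ck_on k S (\<lambda>x. frechet_derivative f (at x) v))"

text \<open>Used only for open subsets \<open>S\<close> of Euclidean spaces.\<close>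

definition smooth_on :: "'a::real_normed_vector set \<Rightarrow> ('a \<Rightarrow> 'b::real_normed_vector) \<Rightarrow> bool" where
  "smooth_on S f \<longleftrightarrow> (\<forall>k. Ck_on k S f)"

type_synonym 'g chart = "'g set \<times> ('g \<Rightarrow> real^3)"

definition dom :: "'g chart \<Rightarrow> 'g set" where
  "dom c = fst c"

definition coord :: "'g chart \<Rightarrow> 'g \<Rightarrow> real^3" where
  "coord c = snd c"

definition param :: "'g chart \<Rightarrow> real^3 \<Rightarrow> 'g" where
  "param c = inv_into (dom c) (coord c)"

definition smooth_atlas :: "'g::topological_space chart set \<Rightarrow> bool" where
  "smooth_atlas A \<longleftrightarrow>
     (\<Union>c\<in>A. dom c) = UNIV \<and>
     (\<forall>c\<in>A. open (dom c) \<and> open (coord c ` dom c) \<and>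
        homeomorphism (dom c) (coord c ` dom c) (coord c) (param c)) \<and>
     (\<forall>c\<in>A. \<forall>d\<in>A. smooth_on (coord c ` (dom c \<inter> dom d)) (coord d \<circ> param c))"

text \<open>
  The group operation is written additively because \<^class>\<open>group_add\<close> is the library's class of
  not necessarily commutative groups; commutativity is not assumed.
\<close>

definition lie_group ::
  "'g::{topological_group_add, t2_space, second_countable_topology} chart set \<Rightarrow> bool" where
  "lie_group A \<longleftrightarrow>
     smooth_atlas A \<and>
     (\<forall>a\<in>A. \<forall>b\<in>A. \<forall>c\<in>A.
        smooth_on {(x, y). x \<in> coord a ` dom a \<and> y \<in> coord b ` dom b \<and> param a x + param b y \<in> dom c}
          (\<lambda>(x, y). coord c (param a x + param b y))) \<and>
     (\<forall>a\<in>A. \<forall>c\<in>A.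
        smooth_on {x \<in> coord a ` dom a. - param a x \<in> dom c} (\<lambda>x. coord c (- param a x)))"

subsection \<open>Tangent vectors, vector fields and functions\<close>

text \<open>
  The tangent space at \<open>p\<close> is modelled by \<open>real^3\<close>: a tangent vector at \<open>p\<close> is given by its
  components in one chart around \<open>p\<close>, fixed once and for all.  As this chart varies with \<open>p\<close>,
  smoothness of a vector field has to be read off its components in the charts of the atlas.
\<close>

definition chart_at :: "'g chart set \<Rightarrow> 'g \<Rightarrow> 'g chart" where
  "chart_at A p = (SOME c. c \<in> A \<and> p \<in> dom c)"

definition components :: "'g chart set \<Rightarrow> 'g chart \<Rightarrow> 'g \<Rightarrow> real^3 \<Rightarrow> real^3" where
  "components A c p v =
     frechet_derivative (coord c \<circ> param (chart_at A p)) (at (coord (chart_at A p) p)) v"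

definition tangent_map :: "'g chart set \<Rightarrow> ('g \<Rightarrow> 'g) \<Rightarrow> 'g \<Rightarrow> real^3 \<Rightarrow> real^3" where
  "tangent_map A F p v =
     frechet_derivative (coord (chart_at A (F p)) \<circ> F \<circ> param (chart_at A p))
       (at (coord (chart_at A p) p)) v"

type_synonym 'g vfield = "'g \<Rightarrow> real^3"

definition field_in_chart :: "'g chart set \<Rightarrow> 'g chart \<Rightarrow> 'g vfield \<Rightarrow> real^3 \<Rightarrow> real^3" where
  "field_in_chart A c X x = components A c (param c x) (X (param c x))"

definition smooth_field :: "'g chart set \<Rightarrow> 'g vfield \<Rightarrow> bool" where
  "smooth_field A X \<longleftrightarrow> (\<forall>c\<in>A. smooth_on (coord c ` dom c) (field_in_chart A c X))"

definition smooth_fun :: "'g chart set \<Rightarrow> ('g \<Rightarrow> real) \<Rightarrow> bool" where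
  "smooth_fun A f \<longleftrightarrow> (\<forall>c\<in>A. smooth_on (coord c ` dom c) (f \<circ> param c))"

definition deriv_along :: "'g chart set \<Rightarrow> 'g vfield \<Rightarrow> ('g \<Rightarrow> real) \<Rightarrow> 'g \<Rightarrow> real" where
  "deriv_along A X f p =
     frechet_derivative (f \<circ> param (chart_at A p)) (at (coord (chart_at A p) p)) (X p)"

text \<open>The sign is such that \<open>[X, Y] f = X (Y f) - Y (X f)\<close>.\<close>

definition lie_bracket :: "'g chart set \<Rightarrow> 'g vfield \<Rightarrow> 'g vfield \<Rightarrow> 'g vfield" where
  "lie_bracket A X Y p =
     (let c = chart_at A p; x = coord c p in
        frechet_derivative (field_in_chart A c Y) (at x) (field_in_chart A c X x)
      - frechet_derivative (field_in_chart A c X) (at x) (field_in_chart A c Y x))"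

definition left_invariant_field ::
  "'g::{topological_group_add, t2_space, second_countable_topology} chart set \<Rightarrow> 'g vfield \<Rightarrow> bool" where
  "left_invariant_field A X \<longleftrightarrow>
     smooth_field A X \<and> (\<forall>a p. X (a + p) = tangent_map A ((+) a) p (X p))"

subsection \<open>Metrics and the Levi-Civita connection\<close>

type_synonym 'g metric_tensor = "'g \<Rightarrow> real^3 \<Rightarrow> real^3 \<Rightarrow> real"

definition on_fields :: "'g metric_tensor \<Rightarrow> 'g vfield \<Rightarrow> 'g vfield \<Rightarrow> 'g \<Rightarrow> real" where
  "on_fields g X Y p = g p (X p) (Y p)"

definition pseudo_riemannian_metric :: "'g chart set \<Rightarrow> 'g metric_tensor \<Rightarrow> bool" where
  "pseudo_riemannian_metric A g \<longleftrightarrow>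
     (\<forall>p. bilinear (g p) \<and> (\<forall>v w. g p v w = g p w v) \<and> (\<forall>v. (\<forall>w. g p v w = 0) \<longrightarrow> v = 0)) \<and>
     (\<forall>X Y. smooth_field A X \<longrightarrow> smooth_field A Y \<longrightarrow> smooth_fun A (on_fields g X Y))"

definition minkowski :: "3 \<Rightarrow> 3 \<Rightarrow> real" where
  "minkowski i j = (if i \<noteq> j then 0 else if i = 3 then -1 else 1)"

definition lorentzian_metric :: "'g chart set \<Rightarrow> 'g metric_tensor \<Rightarrow> bool" where
  "lorentzian_metric A g \<longleftrightarrow>
     pseudo_riemannian_metric A g \<and>
     (\<forall>p. \<exists>b :: 3 \<Rightarrow> real^3. \<forall>i j. g p (b i) (b j) = minkowski i j)"

definition left_invariant_metric ::
  "'g::{topological_group_add, t2_space, second_countable_topology} chart set \<Rightarrow> 'g metric_tensor \<Rightarrow> bool" where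
  "left_invariant_metric A g \<longleftrightarrow>
     (\<forall>a p v w. g (a + p) (tangent_map A ((+) a) p v) (tangent_map A ((+) a) p w) = g p v w)"

type_synonym 'g connection = "'g vfield \<Rightarrow> 'g vfield \<Rightarrow> 'g vfield"

definition affine_connection :: "'g chart set \<Rightarrow> 'g connection \<Rightarrow> bool" where
  "affine_connection A D \<longleftrightarrow>
     (\<forall>X Y. smooth_field A X \<longrightarrow> smooth_field A Y \<longrightarrow> smooth_field A (D X Y)) \<and>
     (\<forall>X Y Z. smooth_field A X \<longrightarrow> smooth_field A Y \<longrightarrow> smooth_field A Z \<longrightarrow>
        D (\<lambda>p. X p + Y p) Z = (\<lambda>p. D X Z p + D Y Z p) \<and>
        D X (\<lambda>p. Y p + Z p) = (\<lambda>p. D X Y p + D X Z p)) \<and>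
     (\<forall>f X Y. smooth_fun A f \<longrightarrow> smooth_field A X \<longrightarrow> smooth_field A Y \<longrightarrow>
        D (\<lambda>p. f p *\<^sub>R X p) Y = (\<lambda>p. f p *\<^sub>R D X Y p) \<and>
        D X (\<lambda>p. f p *\<^sub>R Y p) = (\<lambda>p. deriv_along A X f p *\<^sub>R Y p + f p *\<^sub>R D X Y p))"

definition levi_civita :: "'g chart set \<Rightarrow> 'g metric_tensor \<Rightarrow> 'g connection \<Rightarrow> bool" where
  "levi_civita A g D \<longleftrightarrow>
     affine_connection A D \<and>
     (\<forall>X Y. smooth_field A X \<longrightarrow> smooth_field A Y \<longrightarrow>
        (\<forall>p. D X Y p - D Y X p = lie_bracket A X Y p)) \<and>
     (\<forall>X Y Z. smooth_field A X \<longrightarrow> smooth_field A Y \<longrightarrow> smooth_field A Z \<longrightarrow>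
        (\<forall>p. deriv_along A X (on_fields g Y Z) p
             = on_fields g (D X Y) Z p + on_fields g Y (D X Z) p))"

subsection \<open>Curvature and the Cotton tensor\<close>

text \<open>
  Covariant 2-tensor fields derived from the connection act on smooth vector fields; their values
  on other arguments are irrelevant.
\<close>

type_synonym 'g tensor2 = "'g vfield \<Rightarrow> 'g vfield \<Rightarrow> 'g \<Rightarrow> real"

definition curvature ::
  "'g chart set \<Rightarrow> 'g connection \<Rightarrow> 'g vfield \<Rightarrow> 'g vfield \<Rightarrow> 'g vfield \<Rightarrow> 'g vfield" where
  "curvature A D X Y Z p = D (lie_bracket A X Y) Z p - (D X (D Y Z) p - D Y (D X Z) p)"

text \<open>The description inside \<open>THE\<close> is the endomorphism \<open>z \<mapsto> R(X, z)Y\<close> of the tangent space at \<open>p\<close>.\<close>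

definition ricci :: "'g chart set \<Rightarrow> 'g connection \<Rightarrow> 'g tensor2" where
  "ricci A D X Y p =
     trace (matrix (THE L :: real^3 \<Rightarrow> real^3.
       linear L \<and> (\<forall>Z. smooth_field A Z \<longrightarrow> L (Z p) = curvature A D X Z Y p)))"

text \<open>The description inside \<open>THE\<close> is the Ricci operator, \<open>g(QX, Y) = \<rho>(X, Y)\<close>.\<close>

definition scalar_curvature ::
  "'g chart set \<Rightarrow> 'g metric_tensor \<Rightarrow> 'g connection \<Rightarrow> 'g \<Rightarrow> real" where
  "scalar_curvature A g D p =
     trace (matrix (THE Q :: real^3 \<Rightarrow> real^3.
       linear Q \<and> (\<forall>X Y. smooth_field A X \<longrightarrow> smooth_field A Y \<longrightarrow>
         g p (Q (X p)) (Y p) = ricci A D X Y p)))"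

definition schouten :: "'g chart set \<Rightarrow> 'g metric_tensor \<Rightarrow> 'g connection \<Rightarrow> 'g tensor2" where
  "schouten A g D X Y p = ricci A D X Y p - scalar_curvature A g D p / 4 * on_fields g X Y p"

definition covariant_derivative ::
  "'g chart set \<Rightarrow> 'g connection \<Rightarrow> 'g vfield \<Rightarrow> 'g tensor2 \<Rightarrow> 'g tensor2" where
  "covariant_derivative A D X T Y Z p =
     deriv_along A X (T Y Z) p - T (D X Y) Z p - T Y (D X Z) p"

definition cotton3 ::
  "'g chart set \<Rightarrow> 'g metric_tensor \<Rightarrow> 'g connection \<Rightarrow>
   'g vfield \<Rightarrow> 'g vfield \<Rightarrow> 'g vfield \<Rightarrow> 'g \<Rightarrow> real" where
  "cotton3 A g D X Y Z p =
     covariant_derivative A D X (schouten A g D) Y Z p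
   - covariant_derivative A D Y (schouten A g D) X Z p"

definition levi_civita_symbol :: "3 \<Rightarrow> 3 \<Rightarrow> 3 \<Rightarrow> real" where
  "levi_civita_symbol i j k =
     (if (i, j, k) \<in> {(1, 2, 3), (2, 3, 1), (3, 1, 2)} then 1
      else if (i, j, k) \<in> {(2, 1, 3), (1, 3, 2), (3, 2, 1)} then -1
      else 0)"

text \<open>
  The components \<open>C\<^sub>n\<^sub>m\<^sub>i\<close>, \<open>g\<^sub>l\<^sub>j\<close> and \<open>det g\<close> are taken in a global frame \<open>E\<close>, which determines the
  orientation: two frames of the same orientation give the same tensor.  The remaining indices
  \<open>i\<close>, \<open>j\<close> are the slots \<open>Y\<close>, \<open>Z\<close>.
\<close>

definition cotton2 ::
  "'g chart set \<Rightarrow> 'g metric_tensor \<Rightarrow> 'g connection \<Rightarrow> (3 \<Rightarrow> 'g vfield) \<Rightarrow> 'g tensor2" where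
  "cotton2 A g D E Y Z p =
     1 / (2 * sqrt \<bar>det (\<chi> i j. on_fields g (E i) (E j) p)\<bar>) *
     (\<Sum>n\<in>UNIV. \<Sum>m\<in>UNIV. \<Sum>l\<in>UNIV.
        cotton3 A g D (E n) (E m) Y p * levi_civita_symbol n m l * on_fields g (E l) Z p)"

definition lie_derivative_metric ::
  "'g chart set \<Rightarrow> 'g metric_tensor \<Rightarrow> 'g vfield \<Rightarrow> 'g tensor2" where
  "lie_derivative_metric A g X Y Z p =
     deriv_along A X (on_fields g Y Z) p
   - on_fields g (lie_bracket A X Y) Z p - on_fields g Y (lie_bracket A X Z) p"

definition cotton_soliton ::
  "'g chart set \<Rightarrow> 'g metric_tensor \<Rightarrow> 'g connection \<Rightarrow> (3 \<Rightarrow> 'g vfield) \<Rightarrow> 'g vfield \<Rightarrow> bool" where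
  "cotton_soliton A g D E X \<longleftrightarrow>
     smooth_field A X \<and>
     (\<exists>lam::real. \<forall>Y Z p. smooth_field A Y \<longrightarrow> smooth_field A Z \<longrightarrow>
        lie_derivative_metric A g X Y Z p + cotton2 A g D E Y Z p = lam * on_fields g Y Z p)"

definition cotton_trivial ::
  "'g chart set \<Rightarrow> 'g metric_tensor \<Rightarrow> 'g connection \<Rightarrow> (3 \<Rightarrow> 'g vfield) \<Rightarrow> bool" where
  "cotton_trivial A g D E \<longleftrightarrow>
     (\<forall>Y Z p. smooth_field A Y \<longrightarrow> smooth_field A Z \<longrightarrow> cotton2 A g D E Y Z p = 0)"

subsection \<open>Type Ia\<close>

text \<open>
  Three orthonormal left-invariant fields are linearly independent at every point, so they are
  automatically a basis of the Lie algebra.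
\<close>

definition type_Ia_basis ::
  "'g::{topological_group_add, t2_space, second_countable_topology} chart set \<Rightarrow> 'g metric_tensor \<Rightarrow>
   (3 \<Rightarrow> 'g vfield) \<Rightarrow> real \<Rightarrow> real \<Rightarrow> real \<Rightarrow> bool" where
  "type_Ia_basis A g e \<alpha> \<beta> \<gamma> \<longleftrightarrow>
     (\<forall>i. left_invariant_field A (e i)) \<and>
     (\<forall>i j p. on_fields g (e i) (e j) p = minkowski i j) \<and>
     lie_bracket A (e 1) (e 2) = (\<lambda>p. - \<gamma> *\<^sub>R e 3 p) \<and>
     lie_bracket A (e 1) (e 3) = (\<lambda>p. - \<beta> *\<^sub>R e 2 p) \<and>
     lie_bracket A (e 2) (e 3) = (\<lambda>p. \<alpha> *\<^sub>R e 1 p)"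

end

theory Submission
  imports Defs
begin

text \<open>
  Let \<open>\<eta>\<^sub>i = g(e\<^sub>i, e\<^sub>i)\<close>, and let \<open>\<nabla>\<^sub>i\<close> be the covariant derivative along \<open>e\<^sub>i\<close>.
  The bracket of two frame fields is a multiple of the third one, so by Koszul's formula
  \<open>\<nabla>\<^sub>i e\<^sub>j = \<Sum>\<^sub>k \<eta>\<^sub>k \<epsilon>\<^sub>i\<^sub>j\<^sub>k \<mu>\<^sub>i e\<^sub>k\<close> with constants \<open>\<mu>\<^sub>i\<close>.  Three consequences decide the matter.

  First, the Ricci tensor and hence the Schouten tensor are diagonal in the frame with constant
  entries.  Then \<open>C\<^sub>n\<^sub>m\<^sub>i\<close> vanishes unless \<open>n, m, i\<close> are distinct, so the \<open>(0,2)\<close>-Cotton tensor is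
  diagonal as well (\<open>cotton2_diagonal\<close>).  Secondly, the Cotton tensor is trace-free, because its trace
  is a multiple of the total antisymmetrisation of \<open>\<nabla>S\<close> with \<open>S\<close> symmetric (\<open>cotton2_trace_free\<close>).  Thirdly, for a
  left-invariant \<open>X\<close> the diagonal entries \<open>2 g(\<nabla>\<^sub>i X, e\<^sub>i)\<close> of \<open>\<L>\<^sub>Xg\<close> vanish
  (\<open>lie_derivative_diagonal\<close>).

  On the diagonal the soliton equation therefore reads \<open>C(e\<^sub>i, e\<^sub>i) = \<lambda> \<eta>\<^sub>i\<close>.  Taking the trace gives
  \<open>\<lambda> = 0\<close>, so the diagonal of \<open>C\<close> vanishes.  Off the diagonal \<open>C\<close> vanishes anyway, and so
  \<open>\<L>\<^sub>Xg\<close> vanishes on the frame.  As \<open>\<L>\<^sub>Xg\<close> is a tensor, \<open>X\<close> is a Killing field, and the soliton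
  equation leaves \<open>C = 0\<close> (\<open>invariant_soliton_trivial\<close>).

  The computation has to be justified from the definitions.  Ricci and scalar curvature are traces of
  endomorphisms characterised by their values on all smooth fields.  Such an endomorphism exists
  because the curvature is linear over smooth functions in each argument, and it is unique because the
  frame spans every tangent space.  Function-linearity of \<open>R(X, Z)Y\<close> in \<open>Y\<close> amounts to
  \<open>[X, Z] f = X (Z f) - Z (X f)\<close>.  For a bracket given by coordinates, this is the symmetry of second
  derivatives (\<open>mixed_second_derivatives_commute\<close>, \<open>deriv_along_lie_bracket\<close>).
\<close>

section \<open>Calculus: closure properties of smooth maps and symmetry of second derivatives\<close>

lemma frechet_derivative_cong_open:
  assumes "open S" "x \<in> S" "\<And>y. y \<in> S \<Longrightarrow> f y = g y"
  shows "frechet_derivative f (at x) = frechet_derivative g (at x)"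
proof -
  have "(f has_derivative F) (at x) \<longleftrightarrow> (g has_derivative F) (at x)" for F
    by (rule iffI; erule has_derivative_transform_within_open[OF _ assms(1,2)])
      (simp_all add: assms(3))
  then show ?thesis
    by (simp add: frechet_derivative_def)
qed

lemma differentiable_cong_open:
  assumes "open S" "x \<in> S" "\<And>y. y \<in> S \<Longrightarrow> f y = g y" "f differentiable (at x)"
  shows "g differentiable (at x)"
  using assms unfolding differentiable_def by (blast intro: has_derivative_transform_within_open)

lemma Ck_on_cong:
  assumes "open S" "\<And>x. x \<in> S \<Longrightarrow> f x = g x" "Ck_on k S f"
  shows "Ck_on k S g"
  using assms(2,3)
proof (induction k arbitrary: f g)
  case 0
  then show ?case by (simp cong: continuous_on_cong)
next
  case (Suc k)
  have "Ck_on k S (\<lambda>x. frechet_derivative g (at x) v)" for v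
  proof (rule Suc.IH)
    show "frechet_derivative f (at x) v = frechet_derivative g (at x) v" if "x \<in> S" for x
      by (rule fun_cong[OF frechet_derivative_cong_open[OF assms(1) that Suc.prems(1)]])
    show "Ck_on k S (\<lambda>x. frechet_derivative f (at x) v)"
      using Suc.prems(2) by simp
  qed
  moreover have "g differentiable (at x)" if "x \<in> S" for x
    using differentiable_cong_open[OF assms(1) that Suc.prems(1)] Suc.prems(2) that by simp
  ultimately show ?case by simp
qed

lemma Ck_on_const: "Ck_on k S (\<lambda>x. c)"
  by (induction k arbitrary: c) auto

lemma Ck_on_SucD: "Ck_on (Suc k) S f \<Longrightarrow> Ck_on k S f"
proof (induction k arbitrary: f)
  case 0
  then show ?case
    by (simp add: continuous_at_imp_continuous_on differentiable_imp_continuous_within)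
next
  case (Suc k)
  have "Ck_on (Suc k) S (\<lambda>x. frechet_derivative f (at x) v)" for v
    using Suc.prems unfolding Ck_on.simps(2)[of "Suc k"] by blast
  then have "Ck_on k S (\<lambda>x. frechet_derivative f (at x) v)" for v
    by (rule Suc.IH)
  moreover have "\<forall>x\<in>S. f differentiable (at x)"
    using Suc.prems unfolding Ck_on.simps(2)[of "Suc k"] by blast
  ultimately show ?case
    unfolding Ck_on.simps(2)[of k] by blast
qed

lemma Ck_on_add:
  assumes "open S" "Ck_on k S f" "Ck_on k S g"
  shows "Ck_on k S (\<lambda>x. f x + g x)"
  using assms(2,3)
proof (induction k arbitrary: f g)
  case 0
  then show ?case by (simp add: continuous_on_add)
next
  case (Suc k)
  have "Ck_on k S (\<lambda>x. frechet_derivative (\<lambda>x. f x + g x) (at x) v)" for v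
  proof (rule Ck_on_cong[OF assms(1)])
    show "Ck_on k S (\<lambda>x. frechet_derivative f (at x) v + frechet_derivative g (at x) v)"
      using Suc by auto
    show "frechet_derivative f (at x) v + frechet_derivative g (at x) v
        = frechet_derivative (\<lambda>x. f x + g x) (at x) v" if "x \<in> S" for x
      using Suc.prems that by (intro fun_cong[OF frechet_derivative_at] has_derivative_add)
        (simp_all add: frechet_derivative_works[symmetric])
  qed
  then show ?case
    using Suc.prems by simp
qed

lemma frechet_derivative_scaleR_fun:
  assumes "f differentiable (at x)" "g differentiable (at x)"
  shows "frechet_derivative (\<lambda>x. f x *\<^sub>R g x) (at x) v
    = f x *\<^sub>R frechet_derivative g (at x) v + frechet_derivative f (at x) v *\<^sub>R g x"
  by (intro fun_cong[OF frechet_derivative_at, symmetric] has_derivative_scaleR)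
    (use assms in \<open>simp_all add: frechet_derivative_works[symmetric]\<close>)

lemma Ck_on_scaleR:
  fixes f :: "'a::real_normed_vector \<Rightarrow> real" and g :: "'a \<Rightarrow> 'b::real_normed_vector"
  assumes "open S" "Ck_on k S f" "Ck_on k S g"
  shows "Ck_on k S (\<lambda>x. f x *\<^sub>R g x)"
  using assms(2,3)
proof (induction k arbitrary: f g)
  case 0
  then show ?case by (simp add: continuous_on_scaleR)
next
  case (Suc k)
  have "Ck_on k S (\<lambda>x. frechet_derivative (\<lambda>x. f x *\<^sub>R g x) (at x) v)" for v
  proof (rule Ck_on_cong[OF assms(1)])
    show "Ck_on k S (\<lambda>x. f x *\<^sub>R frechet_derivative g (at x) v + frechet_derivative f (at x) v *\<^sub>R g x)"
      using Suc.prems Ck_on_SucD[OF Suc.prems(1)] Ck_on_SucD[OF Suc.prems(2)]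
      by (intro Ck_on_add[OF assms(1)] Suc.IH) simp_all
    show "f x *\<^sub>R frechet_derivative g (at x) v + frechet_derivative f (at x) v *\<^sub>R g x
        = frechet_derivative (\<lambda>x. f x *\<^sub>R g x) (at x) v" if "x \<in> S" for x
      using Suc.prems that by (simp add: frechet_derivative_scaleR_fun)
  qed
  then show ?case
    using Suc.prems by (simp add: differentiable_scaleR)
qed

lemma has_real_derivative_along_line:
  fixes f :: "'a::real_normed_vector \<Rightarrow> real"
  assumes "(f has_derivative F) (at (a + s *\<^sub>R u))"
  shows "((\<lambda>s. f (a + s *\<^sub>R u)) has_real_derivative F u) (at s)"
proof -
  have "((\<lambda>s. a + s *\<^sub>R u) has_derivative (\<lambda>r. r *\<^sub>R u)) (at s)"
    by (auto intro!: derivative_eq_intros)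
  then have "((\<lambda>s. f (a + s *\<^sub>R u)) has_derivative (\<lambda>r. F (r *\<^sub>R u))) (at s)"
    using has_derivative_compose[where g = f] assms by blast
  then show ?thesis
    by (simp add: has_field_derivative_def linear_scale[OF has_derivative_linear[OF assms]] mult_commute_abs)
qed

text \<open>
  Applying the mean value theorem first in the direction \<open>u\<close> and then in the direction \<open>v\<close>
  turns the second difference over a small parallelogram into one value of the mixed derivative.
  The left-hand side is symmetric in \<open>u\<close> and \<open>v\<close>, and this is what forces the two mixed
  derivatives to agree.
\<close>

lemma mixed_difference_quotient:
  fixes f :: "'a::real_normed_vector \<Rightarrow> real"
  assumes "Ck_on 2 S f" "h > 0"
    and S: "\<And>s t. 0 \<le> s \<Longrightarrow> s \<le> h \<Longrightarrow> 0 \<le> t \<Longrightarrow> t \<le> h \<Longrightarrow> x + s *\<^sub>R u + t *\<^sub>R v \<in> S"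
  obtains s t where "0 < s" "s < h" "0 < t" "t < h"
    "f (x + h *\<^sub>R u + h *\<^sub>R v) - f (x + h *\<^sub>R u) - f (x + h *\<^sub>R v) + f x
     = h\<^sup>2 * frechet_derivative (\<lambda>y. frechet_derivative f (at y) u) (at (x + s *\<^sub>R u + t *\<^sub>R v)) v"
proof -
  define fu where "fu y = frechet_derivative f (at y) u" for y
  have df: "(f has_derivative frechet_derivative f (at y)) (at y)" if "y \<in> S" for y
    using assms(1) that by (simp add: numeral_2_eq_2 frechet_derivative_works)
  have dfu: "(fu has_derivative frechet_derivative fu (at y)) (at y)" if "y \<in> S" for y
    using assms(1) that unfolding fu_def by (simp add: numeral_2_eq_2 frechet_derivative_works)
  have 1: "((\<lambda>s. f (x + s *\<^sub>R u + t *\<^sub>R v)) has_real_derivative fu (x + s *\<^sub>R u + t *\<^sub>R v)) (at s)"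
    if "0 \<le> s" "s \<le> h" "0 \<le> t" "t \<le> h" for s t
    using has_real_derivative_along_line[of f _ "x + t *\<^sub>R v" s u] df[OF S[OF that]]
    by (simp add: fu_def add.assoc add.commute[of "t *\<^sub>R v"])
  have 2: "((\<lambda>t. fu (x + s *\<^sub>R u + t *\<^sub>R v)) has_real_derivative
      frechet_derivative fu (at (x + s *\<^sub>R u + t *\<^sub>R v)) v) (at t)"
    if "0 \<le> s" "s \<le> h" "0 \<le> t" "t \<le> h" for s t
    by (rule has_real_derivative_along_line[OF dfu[OF S[OF that]]])
  \<comment> \<open>The summand \<open>0 *\<^sub>R v\<close> lets the facts \<open>1\<close> and \<open>2\<close> apply on both sides of the parallelogram.\<close>
  define \<phi> where "\<phi> s = f (x + s *\<^sub>R u + h *\<^sub>R v) - f (x + s *\<^sub>R u + 0 *\<^sub>R v)" for s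
  have "\<exists>s. 0 < s \<and> s < h \<and> \<phi> h - \<phi> 0 = (h - 0) *
      (fu (x + s *\<^sub>R u + h *\<^sub>R v) - fu (x + s *\<^sub>R u + 0 *\<^sub>R v))"
  proof (rule MVT2[OF \<open>h > 0\<close>])
    show "(\<phi> has_real_derivative fu (x + s *\<^sub>R u + h *\<^sub>R v) - fu (x + s *\<^sub>R u + 0 *\<^sub>R v)) (at s)"
      if "0 \<le> s" "s \<le> h" for s
      unfolding \<phi>_def using that \<open>h > 0\<close> by (intro DERIV_diff 1) auto
  qed
  then obtain s where s: "0 < s" "s < h"
    "\<phi> h - \<phi> 0 = h * (fu (x + s *\<^sub>R u + h *\<^sub>R v) - fu (x + s *\<^sub>R u + 0 *\<^sub>R v))"
    by auto
  have "\<exists>t. 0 < t \<and> t < h \<and> fu (x + s *\<^sub>R u + h *\<^sub>R v) - fu (x + s *\<^sub>R u + 0 *\<^sub>R v)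
      = (h - 0) * frechet_derivative fu (at (x + s *\<^sub>R u + t *\<^sub>R v)) v"
    by (rule MVT2[OF \<open>h > 0\<close>, of "\<lambda>t. fu (x + s *\<^sub>R u + t *\<^sub>R v)"]) (use s in \<open>auto intro!: 2\<close>)
  then obtain t where "0 < t" "t < h" "fu (x + s *\<^sub>R u + h *\<^sub>R v) - fu (x + s *\<^sub>R u + 0 *\<^sub>R v)
      = h * frechet_derivative fu (at (x + s *\<^sub>R u + t *\<^sub>R v)) v"
    by auto
  with s show ?thesis
    using that[of s t] by (simp add: \<phi>_def power2_eq_square flip: fu_def)
qed

theorem mixed_second_derivatives_commute:
  fixes f :: "'a::real_normed_vector \<Rightarrow> real"
  assumes "open S" "x \<in> S" "Ck_on 2 S f"
  shows "frechet_derivative (\<lambda>y. frechet_derivative f (at y) u) (at x) v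
       = frechet_derivative (\<lambda>y. frechet_derivative f (at y) v) (at x) u" (is "?F u v x = ?F v u x")
proof -
  have cont: "isCont (?F a b) x" for a b
    using assms by (simp add: numeral_2_eq_2 continuous_on_eq_continuous_at)
  have "\<bar>?F u v x - ?F v u x\<bar> \<le> \<epsilon>" if "\<epsilon> > 0" for \<epsilon>
  proof -
    have ev: "\<forall>\<^sub>F y in nhds x. dist (?F a b y) (?F a b x) < \<epsilon> / 2" for a b
      using tendsto_at_iff_tendsto_nhds[THEN iffD1, OF cont[unfolded isCont_def]] \<open>\<epsilon> > 0\<close>
      by (rule tendstoD[OF _ half_gt_zero])
    have "\<forall>\<^sub>F y in nhds x. y \<in> S \<and> dist (?F u v y) (?F u v x) < \<epsilon> / 2 \<and> dist (?F v u y) (?F v u x) < \<epsilon> / 2"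
      using eventually_nhds_in_open[OF assms(1,2)] ev by (intro eventually_conj) auto
    then obtain d where d: "d > 0" and close: "\<And>y. dist y x < d \<Longrightarrow>
        y \<in> S \<and> dist (?F u v y) (?F u v x) < \<epsilon> / 2 \<and> dist (?F v u y) (?F v u x) < \<epsilon> / 2"
      unfolding eventually_nhds_metric by blast
    \<comment> \<open>Small enough for the parallelogram with sides \<open>h u\<close> and \<open>h v\<close> to stay within distance \<open>d\<close> of \<open>x\<close>.\<close>
    define h where "h = d / (norm u + norm v + 1)"
    have n: "norm u + norm v + 1 > 0"
      by (simp add: add_nonneg_pos)
    have h: "h > 0" using d n by (simp add: h_def)
    have bd: "dist (x + s *\<^sub>R a + t *\<^sub>R b) x < d"
      if "0 \<le> s" "s \<le> h" "0 \<le> t" "t \<le> h" "(a, b) \<in> {(u, v), (v, u)}" for s t a b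
    proof -
      have "dist (x + s *\<^sub>R a + t *\<^sub>R b) x \<le> s * norm a + t * norm b"
        using norm_triangle_ineq[of "s *\<^sub>R a" "t *\<^sub>R b"] that by (simp add: dist_norm add.assoc)
      also have "\<dots> \<le> h * norm a + h * norm b"
        using that by (intro add_mono mult_right_mono) auto
      also have "\<dots> < h * (norm u + norm v + 1)"
        using h that by (auto simp: algebra_simps)
      also have "\<dots> = d" using n by (simp add: h_def)
      finally show ?thesis .
    qed
    obtain s t where st: "0 < s" "s < h" "0 < t" "t < h"
      "f (x + h *\<^sub>R u + h *\<^sub>R v) - f (x + h *\<^sub>R u) - f (x + h *\<^sub>R v) + f x
        = h\<^sup>2 * ?F u v (x + s *\<^sub>R u + t *\<^sub>R v)"
      using mixed_difference_quotient[OF assms(3) h, of x u v] close[OF bd[of _ _ u v]] by auto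
    obtain s' t' where st': "0 < s'" "s' < h" "0 < t'" "t' < h"
      "f (x + h *\<^sub>R v + h *\<^sub>R u) - f (x + h *\<^sub>R v) - f (x + h *\<^sub>R u) + f x
        = h\<^sup>2 * ?F v u (x + s' *\<^sub>R v + t' *\<^sub>R u)"
      using mixed_difference_quotient[OF assms(3) h, of x v u] close[OF bd[of _ _ v u]] by auto
    have "h\<^sup>2 * ?F u v (x + s *\<^sub>R u + t *\<^sub>R v) = h\<^sup>2 * ?F v u (x + s' *\<^sub>R v + t' *\<^sub>R u)"
      using st(5) st'(5) by (simp add: algebra_simps)
    then have "?F u v (x + s *\<^sub>R u + t *\<^sub>R v) = ?F v u (x + s' *\<^sub>R v + t' *\<^sub>R u)"
      using h by simp
    moreover have "dist (?F u v (x + s *\<^sub>R u + t *\<^sub>R v)) (?F u v x) < \<epsilon> / 2"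
      using st bd[of s t u v] close by simp
    moreover have "dist (?F v u (x + s' *\<^sub>R v + t' *\<^sub>R u)) (?F v u x) < \<epsilon> / 2"
      using st' bd[of s' t' v u] close by simp
    ultimately show ?thesis
      unfolding dist_real_def by linarith
  qed
  then have "\<bar>?F u v x - ?F v u x\<bar> \<le> 0"
    using field_le_epsilon[of "\<bar>?F u v x - ?F v u x\<bar>" 0] by simp
  then show ?thesis by simp
qed

section \<open>Smooth vector fields and functions on a manifold\<close>

lemma chart_at:
  assumes "smooth_atlas A"
  shows "chart_at A p \<in> A" "p \<in> dom (chart_at A p)"
proof -
  have "\<exists>c. c \<in> A \<and> p \<in> dom c"
    using assms unfolding smooth_atlas_def by (metis UNIV_I UN_iff)
  then have "chart_at A p \<in> A \<and> p \<in> dom (chart_at A p)"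
    unfolding chart_at_def by (rule someI_ex)
  then show "chart_at A p \<in> A" "p \<in> dom (chart_at A p)" by auto
qed

lemma
  assumes "smooth_atlas A" "c \<in> A"
  shows open_dom: "open (dom c)"
    and open_chart_image: "open (coord c ` dom c)"
    and continuous_on_param: "continuous_on (coord c ` dom c) (param c)"
    and param_coord: "p \<in> dom c \<Longrightarrow> param c (coord c p) = p"
    and coord_param: "x \<in> coord c ` dom c \<Longrightarrow> coord c (param c x) = x"
    and param_in_dom: "x \<in> coord c ` dom c \<Longrightarrow> param c x \<in> dom c"
proof -
  have c: "open (dom c)" "open (coord c ` dom c)"
    "homeomorphism (dom c) (coord c ` dom c) (coord c) (param c)"
    using assms unfolding smooth_atlas_def by simp_all
  show "open (dom c)" "open (coord c ` dom c)" "continuous_on (coord c ` dom c) (param c)"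
    using c homeomorphism_cont2 by auto
  show "p \<in> dom c \<Longrightarrow> param c (coord c p) = p"
    by (rule homeomorphism_apply1[OF c(3)])
  show "x \<in> coord c ` dom c \<Longrightarrow> coord c (param c x) = x"
    by (rule homeomorphism_apply2[OF c(3)])
  show "x \<in> coord c ` dom c \<Longrightarrow> param c x \<in> dom c"
    using homeomorphism_image2[OF c(3)] by auto
qed

lemma open_overlap:
  assumes "smooth_atlas A" "c \<in> A" "d \<in> A"
  shows "open (coord c ` (dom c \<inter> dom d))"
proof -
  have "coord c ` (dom c \<inter> dom d) = coord c ` dom c \<inter> param c -` dom d"
    using param_coord[OF assms(1,2)] by force
  moreover have "open (param c -` dom d \<inter> coord c ` dom c)"
    using continuous_on_open_vimage[OF open_chart_image[OF assms(1,2)], of "param c"]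
      continuous_on_param[OF assms(1,2)] open_dom[OF assms(1,3)] by blast
  ultimately show ?thesis
    by (simp add: Int_commute)
qed

lemma transition_differentiable:
  assumes "smooth_atlas A" "c \<in> A" "d \<in> A" "p \<in> dom c" "p \<in> dom d"
  shows "(coord d \<circ> param c) differentiable (at (coord c p))"
proof -
  have "smooth_on (coord c ` (dom c \<inter> dom d)) (coord d \<circ> param c)"
    using assms(1-3) unfolding smooth_atlas_def by simp
  then have "Ck_on (Suc 0) (coord c ` (dom c \<inter> dom d)) (coord d \<circ> param c)"
    unfolding smooth_on_def by blast
  then show ?thesis
    using assms by auto
qed

lemma components_linear:
  assumes "smooth_atlas A" "c \<in> A" "p \<in> dom c"
  shows "linear (components A c p)"
  unfolding components_def[abs_def]
  by (intro linear_frechet_derivative transition_differentiable[OF assms(1) _ assms(2) _ assms(3)]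
      chart_at[OF assms(1)])

lemma smooth_fieldD:
  "smooth_field A X \<Longrightarrow> c \<in> A \<Longrightarrow> Ck_on k (coord c ` dom c) (field_in_chart A c X)"
  by (simp add: smooth_field_def smooth_on_def)

lemma smooth_funD:
  "smooth_fun A f \<Longrightarrow> c \<in> A \<Longrightarrow> Ck_on k (coord c ` dom c) (f \<circ> param c)"
  by (simp add: smooth_fun_def smooth_on_def)

lemma smooth_fun_const: "smooth_fun A (\<lambda>p. k)"
  by (simp add: smooth_fun_def smooth_on_def o_def Ck_on_const)

lemma deriv_along_const: "deriv_along A X (\<lambda>p. k) p = 0"
  by (simp add: deriv_along_def o_def)

lemma smooth_field_add:
  assumes "smooth_atlas A" "smooth_field A X" "smooth_field A Y"
  shows "smooth_field A (\<lambda>p. X p + Y p)"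
  unfolding smooth_field_def smooth_on_def
proof (intro ballI allI)
  fix c k assume c: "c \<in> A"
  show "Ck_on k (coord c ` dom c) (field_in_chart A c (\<lambda>p. X p + Y p))"
  proof (rule Ck_on_cong[OF open_chart_image[OF assms(1) c]])
    show "Ck_on k (coord c ` dom c) (\<lambda>x. field_in_chart A c X x + field_in_chart A c Y x)"
      by (intro Ck_on_add open_chart_image[OF assms(1) c] smooth_fieldD[OF _ c] assms)
    fix x assume "x \<in> coord c ` dom c"
    then have "linear (components A c (param c x))"
      by (rule components_linear[OF assms(1) c param_in_dom[OF assms(1) c]])
    then show "field_in_chart A c X x + field_in_chart A c Y x
        = field_in_chart A c (\<lambda>p. X p + Y p) x"
      by (simp add: field_in_chart_def linear_add)
  qed
qed

lemma smooth_field_scaleR: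
  assumes "smooth_atlas A" "smooth_fun A f" "smooth_field A Y"
  shows "smooth_field A (\<lambda>p. f p *\<^sub>R Y p)"
  unfolding smooth_field_def smooth_on_def
proof (intro ballI allI)
  fix c k assume c: "c \<in> A"
  show "Ck_on k (coord c ` dom c) (field_in_chart A c (\<lambda>p. f p *\<^sub>R Y p))"
  proof (rule Ck_on_cong[OF open_chart_image[OF assms(1) c]])
    show "Ck_on k (coord c ` dom c) (\<lambda>x. (f \<circ> param c) x *\<^sub>R field_in_chart A c Y x)"
      by (intro Ck_on_scaleR open_chart_image[OF assms(1) c] smooth_fieldD[OF _ c] smooth_funD[OF _ c] assms)
    fix x assume "x \<in> coord c ` dom c"
    then have "linear (components A c (param c x))"
      by (rule components_linear[OF assms(1) c param_in_dom[OF assms(1) c]])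
    then show "(f \<circ> param c) x *\<^sub>R field_in_chart A c Y x = field_in_chart A c (\<lambda>p. f p *\<^sub>R Y p) x"
      by (simp add: field_in_chart_def linear_scale)
  qed
qed

lemma smooth_field_cmult:
  assumes "smooth_atlas A" "smooth_field A Y"
  shows "smooth_field A (\<lambda>p. k *\<^sub>R Y p)"
  using smooth_field_scaleR[OF assms(1) smooth_fun_const assms(2)] .

lemma smooth_field_diff:
  assumes "smooth_atlas A" "smooth_field A X" "smooth_field A Y"
  shows "smooth_field A (\<lambda>p. X p - Y p)"
  using smooth_field_add[OF assms(1,2) smooth_field_cmult[OF assms(1,3), of "-1"]] by simp

lemma smooth_field_zero:
  assumes "smooth_atlas A"
  shows "smooth_field A (\<lambda>p. 0)"
  unfolding smooth_field_def smooth_on_def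
proof (intro ballI allI)
  fix c k assume c: "c \<in> A"
  show "Ck_on k (coord c ` dom c) (field_in_chart A c (\<lambda>p. 0))"
  proof (rule Ck_on_cong[OF open_chart_image[OF assms c] _ Ck_on_const])
    show "0 = field_in_chart A c (\<lambda>p. 0) x" if "x \<in> coord c ` dom c" for x
      using linear_0[OF components_linear[OF assms c param_in_dom[OF assms c that]]]
      by (simp add: field_in_chart_def)
  qed
qed

lemma smooth_field_sum:
  assumes "smooth_atlas A" "finite I"
    and "\<And>i. i \<in> I \<Longrightarrow> smooth_fun A (f i)" "\<And>i. i \<in> I \<Longrightarrow> smooth_field A (X i)"
  shows "smooth_field A (\<lambda>p. \<Sum>i\<in>I. f i p *\<^sub>R X i p)"
  using assms(2-)
proof (induction I)
  case empty
  then show ?case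
    using smooth_field_zero[OF assms(1)] by simp
next
  case (insert i I)
  then show ?case
    using smooth_field_add[OF assms(1) smooth_field_scaleR[OF assms(1)]] by simp
qed

text \<open>
  The chart used by \<^const>\<open>deriv_along\<close> changes with the point, so a derivative of a derivative can
  only be computed after both have been expressed in one chart.  The chain rule along the transition
  map does this.
\<close>

lemma deriv_along_in_chart:
  assumes "smooth_atlas A" "smooth_fun A f" "c \<in> A" "p \<in> dom c"
  shows "deriv_along A Z f p
    = frechet_derivative (f \<circ> param c) (at (coord c p)) (field_in_chart A c Z (coord c p))"
proof -
  let ?d = "chart_at A p"
  note d = chart_at[OF assms(1), of p]
  have "frechet_derivative (f \<circ> param ?d) (at (coord ?d p))
      = frechet_derivative ((f \<circ> param c) \<circ> (coord c \<circ> param ?d)) (at (coord ?d p))"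
  proof (rule frechet_derivative_cong_open[OF open_overlap[OF assms(1) d(1) assms(3)]])
    show "coord ?d p \<in> coord ?d ` (dom ?d \<inter> dom c)"
      using d assms(4) by auto
    fix y assume "y \<in> coord ?d ` (dom ?d \<inter> dom c)"
    then show "(f \<circ> param ?d) y = ((f \<circ> param c) \<circ> (coord c \<circ> param ?d)) y"
      using param_coord[OF assms(1) d(1)] param_coord[OF assms(1,3)] by auto
  qed
  also have "\<dots> = frechet_derivative (f \<circ> param c) (at (coord c p))
      \<circ> frechet_derivative (coord c \<circ> param ?d) (at (coord ?d p))"
  proof -
    have "(coord c \<circ> param ?d) (coord ?d p) = coord c p"
      using param_coord[OF assms(1) d] by simp
    moreover have "(f \<circ> param c) differentiable (at (coord c p))"
      using smooth_funD[OF assms(2,3), of "Suc 0"] assms(4) by auto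
    ultimately show ?thesis
      using frechet_derivative_compose[OF transition_differentiable[OF assms(1) d(1) assms(3) d(2) assms(4)],
        of "f \<circ> param c"] by simp
  qed
  finally show ?thesis
    using param_coord[OF assms(1,3,4)] by (simp add: deriv_along_def field_in_chart_def components_def)
qed

lemma linear_axis_expansion:
  fixes L :: "real^'n \<Rightarrow> 'b::real_vector"
  assumes "linear L"
  shows "L v = (\<Sum>i\<in>UNIV. v $ i *\<^sub>R L (axis i 1))"
proof -
  have "L v = L (\<Sum>i\<in>UNIV. v $ i *\<^sub>R axis i 1)"
    by (simp add: basis_expansion flip: scalar_mult_eq_scaleR)
  also have "\<dots> = (\<Sum>i\<in>UNIV. v $ i *\<^sub>R L (axis i 1))"
    by (simp add: linear_sum[OF assms] linear_scale[OF assms])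
  finally show ?thesis .
qed

text \<open>
  The Leibniz rule for \<open>y \<mapsto> F'(y)(\<zeta>(y))\<close>.  Its second-order part is written with coordinate
  vectors so that exchanging the two directions only needs the symmetry of the Hessian.
\<close>

lemma derivative_of_directional_derivative:
  fixes F :: "real^'n \<Rightarrow> real" and \<zeta> :: "real^'n \<Rightarrow> real^'n"
  assumes "open S" "x \<in> S" "Ck_on 2 S F" "\<zeta> differentiable (at x)"
  shows "frechet_derivative (\<lambda>y. frechet_derivative F (at y) (\<zeta> y)) (at x) w
    = frechet_derivative F (at x) (frechet_derivative \<zeta> (at x) w)
    + (\<Sum>i\<in>UNIV. \<Sum>j\<in>UNIV. \<zeta> x $ i * w $ j *
        frechet_derivative (\<lambda>y. frechet_derivative F (at y) (axis i 1)) (at x) (axis j 1))"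
proof -
  let ?F = "\<lambda>i y. frechet_derivative F (at y) (axis i 1)"
  have lin: "linear (frechet_derivative F (at y))" if "y \<in> S" for y
    using assms(3) that by (intro linear_frechet_derivative) (simp add: numeral_2_eq_2)
  have dF: "?F i differentiable (at x)" for i
    using assms(2,3) by (simp add: numeral_2_eq_2)
  have "frechet_derivative (\<lambda>y. frechet_derivative F (at y) (\<zeta> y)) (at x)
      = frechet_derivative (\<lambda>y. \<Sum>i\<in>UNIV. \<zeta> y $ i * ?F i y) (at x)"
  proof (rule frechet_derivative_cong_open[OF assms(1,2)])
    show "frechet_derivative F (at y) (\<zeta> y) = (\<Sum>i\<in>UNIV. \<zeta> y $ i * ?F i y)" if "y \<in> S" for y
      using linear_axis_expansion[OF lin[OF that], of "\<zeta> y"] by simp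
  qed
  also have "\<dots> = (\<lambda>w. \<Sum>i\<in>UNIV. \<zeta> x $ i * frechet_derivative (?F i) (at x) w
      + frechet_derivative \<zeta> (at x) w $ i * ?F i x)"
  proof (rule frechet_derivative_at[symmetric], intro has_derivative_sum has_derivative_mult)
    show "((\<lambda>y. \<zeta> y $ i) has_derivative (\<lambda>w. frechet_derivative \<zeta> (at x) w $ i)) (at x)" for i
      using bounded_linear.has_derivative[OF bounded_linear_vec_nth] assms(4)
        frechet_derivative_works by blast
    show "(?F i has_derivative frechet_derivative (?F i) (at x)) (at x)" for i
      using dF frechet_derivative_works by blast
  qed
  finally have "frechet_derivative (\<lambda>y. frechet_derivative F (at y) (\<zeta> y)) (at x) w
      = (\<Sum>i\<in>UNIV. \<zeta> x $ i * frechet_derivative (?F i) (at x) w)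
      + (\<Sum>i\<in>UNIV. frechet_derivative \<zeta> (at x) w $ i * ?F i x)"
    by (simp add: sum.distrib)
  moreover have "frechet_derivative (?F i) (at x) w
      = (\<Sum>j\<in>UNIV. w $ j * frechet_derivative (?F i) (at x) (axis j 1))" for i
    using linear_axis_expansion[OF linear_frechet_derivative[OF dF], of i w] by simp
  moreover have "frechet_derivative F (at x) (frechet_derivative \<zeta> (at x) w)
      = (\<Sum>i\<in>UNIV. frechet_derivative \<zeta> (at x) w $ i * ?F i x)"
    using linear_axis_expansion[OF lin[OF assms(2)], of "frechet_derivative \<zeta> (at x) w"] by simp
  ultimately show ?thesis
    by (simp add: sum_distrib_left mult.assoc)
qed

text \<open>
  In one chart, \<open>X (Z f)\<close> is the derivative of \<open>f\<close> applied to the derivative of the components of \<open>Z\<close>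
  along \<open>X\<close>, plus the Hessian of \<open>f\<close> evaluated at \<open>X\<close> and \<open>Z\<close>.  The Hessian terms cancel in the commutator, and what
  remains is the coordinate expression of the bracket.
\<close>

theorem deriv_along_lie_bracket:
  assumes "smooth_atlas A" "smooth_field A X" "smooth_field A Z" "smooth_fun A f"
    and "smooth_fun A (deriv_along A X f)" "smooth_fun A (deriv_along A Z f)"
  shows "deriv_along A (lie_bracket A X Z) f p
    = deriv_along A X (deriv_along A Z f) p - deriv_along A Z (deriv_along A X f) p"
proof -
  define c where "c = chart_at A p"
  define x where "x = coord c p"
  define F where "F = f \<circ> param c"
  note c = chart_at[OF assms(1), of p, folded c_def]
  let ?S = "coord c ` dom c"
  have S: "open ?S" "x \<in> ?S"
    using open_chart_image[OF assms(1) c(1)] c(2) by (auto simp: x_def)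
  have F: "Ck_on 2 ?S F"
    unfolding F_def by (rule smooth_funD[OF assms(4) c(1)])
  have "\<forall>y\<in>?S. F differentiable (at y)"
    using F unfolding numeral_2_eq_2 Ck_on.simps by blast
  then have linF: "linear (frechet_derivative F (at x))"
    using S(2) by (intro linear_frechet_derivative) blast
  have diff: "field_in_chart A c Y differentiable (at x)" if "smooth_field A Y" for Y
    using smooth_fieldD[OF that c(1), of "Suc 0"] S(2) by auto
  have iter: "deriv_along A V (deriv_along A W f) p
      = frechet_derivative F (at x)
          (frechet_derivative (field_in_chart A c W) (at x) (field_in_chart A c V x))
      + (\<Sum>i\<in>UNIV. \<Sum>j\<in>UNIV. field_in_chart A c W x $ i * field_in_chart A c V x $ j *
          frechet_derivative (\<lambda>y. frechet_derivative F (at y) (axis i 1)) (at x) (axis j 1))"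
    if "smooth_field A W" "smooth_fun A (deriv_along A W f)" for V W
  proof -
    have "frechet_derivative (deriv_along A W f \<circ> param c) (at x)
        = frechet_derivative (\<lambda>y. frechet_derivative F (at y) (field_in_chart A c W y)) (at x)"
    proof (rule frechet_derivative_cong_open[OF S])
      fix y assume "y \<in> ?S"
      then show "(deriv_along A W f \<circ> param c) y = frechet_derivative F (at y) (field_in_chart A c W y)"
        using deriv_along_in_chart[OF assms(1,4) c(1) param_in_dom[OF assms(1) c(1)]]
          coord_param[OF assms(1) c(1)]
        by (simp add: F_def)
    qed
    then show ?thesis
      using derivative_of_directional_derivative[OF S F diff[OF that(1)]]
        deriv_along_in_chart[OF assms(1) that(2) c, of V]
      by (simp add: x_def)
  qed
  have "deriv_along A (lie_bracket A X Z) f p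
      = frechet_derivative F (at x) (lie_bracket A X Z p)"
    by (simp add: deriv_along_def F_def c_def x_def)
  also have "lie_bracket A X Z p
      = frechet_derivative (field_in_chart A c Z) (at x) (field_in_chart A c X x)
      - frechet_derivative (field_in_chart A c X) (at x) (field_in_chart A c Z x)"
    by (simp add: lie_bracket_def c_def x_def Let_def)
  also have "frechet_derivative F (at x) \<dots>
    = frechet_derivative F (at x) (frechet_derivative (field_in_chart A c Z) (at x) (field_in_chart A c X x))
    - frechet_derivative F (at x) (frechet_derivative (field_in_chart A c X) (at x) (field_in_chart A c Z x))"
    by (rule linear_diff[OF linF])
  also have "\<dots> = deriv_along A X (deriv_along A Z f) p - deriv_along A Z (deriv_along A X f) p"
  proof -
    let ?H = "\<lambda>i j. frechet_derivative (\<lambda>y. frechet_derivative F (at y) (axis i 1)) (at x) (axis j 1)"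
    have "(\<Sum>i\<in>UNIV. \<Sum>j\<in>UNIV. field_in_chart A c Z x $ i * field_in_chart A c X x $ j * ?H i j)
        = (\<Sum>j\<in>UNIV. \<Sum>i\<in>UNIV. field_in_chart A c Z x $ i * field_in_chart A c X x $ j * ?H i j)"
      by (rule sum.swap)
    also have "\<dots> = (\<Sum>i\<in>UNIV. \<Sum>j\<in>UNIV. field_in_chart A c X x $ i * field_in_chart A c Z x $ j * ?H i j)"
      by (intro sum.cong refl) (simp add: mixed_second_derivatives_commute[OF S F] mult.commute)
    finally show ?thesis
      using assms by (simp add: iter)
  qed
  finally show ?thesis .
qed

section \<open>The Levi-Civita connection in an orthonormal frame\<close>

text \<open>
  This gives the trace of \<open>\<Sum>\<^sub>i \<phi>\<^sub>i \<otimes> w\<^sub>i\<close> without a change of basis, which suits endomorphisms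
  that are known through a frame rather than through standard coordinates.
\<close>

lemma trace_finite_rank:
  fixes w :: "'i \<Rightarrow> real^'n"
  assumes "\<And>i. i \<in> I \<Longrightarrow> linear (\<phi> i)"
  shows "trace (matrix (\<lambda>v. \<Sum>i\<in>I. \<phi> i v *\<^sub>R w i)) = (\<Sum>i\<in>I. \<phi> i (w i))"
proof -
  have "trace (matrix (\<lambda>v. \<Sum>i\<in>I. \<phi> i v *\<^sub>R w i)) = (\<Sum>k\<in>UNIV. \<Sum>i\<in>I. \<phi> i (axis k 1) * w i $ k)"
    by (simp add: trace_def matrix_def)
  also have "\<dots> = (\<Sum>i\<in>I. \<Sum>k\<in>UNIV. w i $ k * \<phi> i (axis k 1))"
    by (subst sum.swap) (simp add: mult.commute)
  also have "\<dots> = (\<Sum>i\<in>I. \<phi> i (w i))"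
  proof (rule sum.cong[OF refl])
    fix i assume "i \<in> I"
    then show "(\<Sum>k\<in>UNIV. w i $ k * \<phi> i (axis k 1)) = \<phi> i (w i)"
      using linear_axis_expansion[OF assms, of i "w i"] by simp
  qed
  finally show ?thesis .
qed

text \<open>
  The numbers \<open>\<eta> i\<close> are the signs of an arbitrary signature, so that \<open>\<eta> i * g p v (e i p)\<close> is the
  \<open>i\<close>-th coordinate of \<open>v\<close>.
\<close>

locale orthonormal_frame =
  fixes A :: "'g::topological_space chart set"
    and g :: "'g metric_tensor"
    and D :: "'g connection"
    and e :: "3 \<Rightarrow> 'g vfield"
    and \<eta> :: "3 \<Rightarrow> real"
  assumes atlas: "smooth_atlas A"
    and metric: "pseudo_riemannian_metric A g"
    and levi_civita: "levi_civita A g D"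
    and smooth_frame: "smooth_field A (e i)"
    and orthonormal: "g p (e i p) (e j p) = (if i = j then \<eta> i else 0)"
    and sign: "\<eta> i * \<eta> i = 1"
begin

lemma
  shows g_add_left: "g p (u + v) w = g p u w + g p v w"
    and g_scale_left: "g p (k *\<^sub>R u) w = k * g p u w"
    and g_add_right: "g p w (u + v) = g p w u + g p w v"
    and g_scale_right: "g p w (k *\<^sub>R u) = k * g p w u"
    and g_sym: "g p u v = g p v u"
    and linear_g: "linear (\<lambda>u. g p u w)"
    and smooth_on_fields: "smooth_field A X \<Longrightarrow> smooth_field A Y \<Longrightarrow> smooth_fun A (on_fields g X Y)"
proof -
  have bil: "bilinear (g p)" for p
    using metric by (simp add: pseudo_riemannian_metric_def)
  show "g p (u + v) w = g p u w + g p v w" "g p w (u + v) = g p w u + g p w v"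
    "g p (k *\<^sub>R u) w = k * g p u w" "g p w (k *\<^sub>R u) = k * g p w u"
    using bilinear_ladd[OF bil] bilinear_radd[OF bil] bilinear_lmul[OF bil] bilinear_rmul[OF bil]
    by simp_all
  show "linear (\<lambda>u. g p u w)"
    using bil by (simp add: bilinear_def)
  show "g p u v = g p v u"
    using metric unfolding pseudo_riemannian_metric_def by blast
  show "smooth_field A X \<Longrightarrow> smooth_field A Y \<Longrightarrow> smooth_fun A (on_fields g X Y)"
    using metric unfolding pseudo_riemannian_metric_def by blast
qed

lemma g_sum_left: "g p (\<Sum>i\<in>I. u i) w = (\<Sum>i\<in>I. g p (u i) w)"
  by (rule linear_sum[OF linear_g])

lemma g_diff_left: "g p (u - v) w = g p u w - g p v w"
  by (rule linear_diff[OF linear_g])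

lemma frame_coefficient:
  "\<eta> k * g p (\<Sum>i\<in>UNIV. a i *\<^sub>R e i p) (e k p) = a k"
proof -
  have "g p (\<Sum>i\<in>UNIV. a i *\<^sub>R e i p) (e k p) = (\<Sum>i\<in>UNIV. if i = k then a k * \<eta> k else 0)"
    unfolding g_sum_left by (intro sum.cong refl) (simp add: g_scale_left orthonormal)
  then show ?thesis
    using sign[of k] by simp
qed

text \<open>
  Orthonormality makes the three vectors independent, hence they span.  The coordinates are then read
  off with \<open>frame_coefficient\<close>.
\<close>

lemma frame_expansion: "v = (\<Sum>i\<in>UNIV. (\<eta> i * g p v (e i p)) *\<^sub>R e i p)"
proof -
  have \<eta>: "\<eta> i \<noteq> 0" for i
    using sign[of i] by auto
  have inj: "inj (\<lambda>i. e i p)"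
  proof (rule injI)
    fix i j assume "e i p = e j p"
    then have "g p (e i p) (e j p) = \<eta> j" by (simp add: orthonormal)
    then show "i = j" using \<eta>[of j] by (simp add: orthonormal split: if_splits)
  qed
  have "independent (range (\<lambda>i. e i p))"
  proof (rule independent_if_scalars_zero)
    fix f x assume sum: "(\<Sum>x\<in>range (\<lambda>i. e i p). f x *\<^sub>R x) = 0" and "x \<in> range (\<lambda>i. e i p)"
    then obtain k where x: "x = e k p" by auto
    have "(\<Sum>i\<in>UNIV. f (e i p) *\<^sub>R e i p) = 0"
      using sum by (simp add: sum.reindex[OF inj] o_def)
    then show "f x = 0"
      using frame_coefficient[of k p "\<lambda>i. f (e i p)"] linear_0[OF linear_g] by (simp add: x)
  qed simp
  moreover have "card (range (\<lambda>i. e i p)) = DIM(real^3)"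
    by (simp add: card_image[OF inj])
  ultimately have "span (range (\<lambda>i. e i p)) = UNIV"
    using card_eq_dim[of "range (\<lambda>i. e i p)" UNIV] by (simp add: top.extremum_unique)
  then have "v \<in> span (range (\<lambda>i. e i p))" by simp
  then obtain f where "v = (\<Sum>x\<in>range (\<lambda>i. e i p). f x *\<^sub>R x)"
    by (auto simp: span_finite)
  then have v: "v = (\<Sum>i\<in>UNIV. f (e i p) *\<^sub>R e i p)"
    by (simp add: sum.reindex[OF inj] o_def)
  have "\<eta> i * g p v (e i p) = f (e i p)" for i
    unfolding v by (rule frame_coefficient)
  with v show ?thesis by simp
qed

lemma
  assumes "smooth_field A X" "smooth_field A Y"
  shows D_smooth: "smooth_field A (D X Y)"
    and torsion_free: "lie_bracket A X Y = (\<lambda>p. D X Y p - D Y X p)"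
    and D_add_left: "smooth_field A Z \<Longrightarrow> D (\<lambda>p. X p + Y p) Z = (\<lambda>p. D X Z p + D Y Z p)"
    and D_add_right: "smooth_field A Z \<Longrightarrow> D Z (\<lambda>p. X p + Y p) = (\<lambda>p. D Z X p + D Z Y p)"
    and D_scale_left: "smooth_fun A f \<Longrightarrow> D (\<lambda>p. f p *\<^sub>R X p) Y = (\<lambda>p. f p *\<^sub>R D X Y p)"
    and D_scale_right: "smooth_fun A f \<Longrightarrow>
      D X (\<lambda>p. f p *\<^sub>R Y p) = (\<lambda>p. deriv_along A X f p *\<^sub>R Y p + f p *\<^sub>R D X Y p)"
    and metric_compatible: "smooth_field A Z \<Longrightarrow>
      deriv_along A Z (on_fields g X Y) p = g p (D Z X p) (Y p) + g p (X p) (D Z Y p)"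
proof -
  have aff: "affine_connection A D"
    using levi_civita by (simp add: levi_civita_def)
  show "smooth_field A (D X Y)"
    "smooth_field A Z \<Longrightarrow> D (\<lambda>p. X p + Y p) Z = (\<lambda>p. D X Z p + D Y Z p)"
    "smooth_field A Z \<Longrightarrow> D Z (\<lambda>p. X p + Y p) = (\<lambda>p. D Z X p + D Z Y p)"
    "smooth_fun A f \<Longrightarrow> D (\<lambda>p. f p *\<^sub>R X p) Y = (\<lambda>p. f p *\<^sub>R D X Y p)"
    "smooth_fun A f \<Longrightarrow>
      D X (\<lambda>p. f p *\<^sub>R Y p) = (\<lambda>p. deriv_along A X f p *\<^sub>R Y p + f p *\<^sub>R D X Y p)"
    using aff assms unfolding affine_connection_def by blast+
  show "lie_bracket A X Y = (\<lambda>p. D X Y p - D Y X p)"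
    using levi_civita assms by (simp add: levi_civita_def fun_eq_iff)
  show "deriv_along A Z (on_fields g X Y) p = g p (D Z X p) (Y p) + g p (X p) (D Z Y p)"
    if "smooth_field A Z"
    using levi_civita assms that unfolding levi_civita_def on_fields_def by blast
qed

lemma lie_bracket_smooth:
  assumes "smooth_field A X" "smooth_field A Y"
  shows "smooth_field A (lie_bracket A X Y)"
  using assms by (simp add: torsion_free smooth_field_diff[OF atlas] D_smooth)

lemma
  assumes "smooth_field A X" "smooth_field A Y"
  shows D_cmult_left: "D (\<lambda>p. k *\<^sub>R X p) Y = (\<lambda>p. k *\<^sub>R D X Y p)"
    and D_cmult_right: "D X (\<lambda>p. k *\<^sub>R Y p) = (\<lambda>p. k *\<^sub>R D X Y p)"
  using D_scale_left[OF assms smooth_fun_const] D_scale_right[OF assms smooth_fun_const]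
  by (simp_all add: deriv_along_const)

text \<open>
  The Leibniz rule \<open>(X f) e\<^sub>1 = \<nabla>\<^sub>X(f e\<^sub>1) - f \<nabla>\<^sub>Xe\<^sub>1\<close> exhibits \<open>(X f) e\<^sub>1\<close> as a smooth field, and
  pairing it with \<open>e\<^sub>1\<close> recovers \<open>X f\<close> up to sign.  This replaces a computation in charts.
\<close>

lemma smooth_deriv_along:
  assumes "smooth_field A X" "smooth_fun A f"
  shows "smooth_fun A (deriv_along A X f)"
proof -
  let ?W = "\<lambda>p. deriv_along A X f p *\<^sub>R e 1 p"
  have "?W = (\<lambda>p. D X (\<lambda>p. f p *\<^sub>R e 1 p) p - f p *\<^sub>R D X (e 1) p)"
    by (simp add: D_scale_right[OF assms(1) smooth_frame assms(2)])
  then have "smooth_field A ?W"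
    by (simp only:) (intro smooth_field_diff smooth_field_scaleR D_smooth atlas assms smooth_frame)
  then have "smooth_fun A (on_fields g ?W (\<lambda>p. \<eta> 1 *\<^sub>R e 1 p))"
    by (intro smooth_on_fields smooth_field_cmult atlas smooth_frame)
  also have "on_fields g ?W (\<lambda>p. \<eta> 1 *\<^sub>R e 1 p) = deriv_along A X f"
    using sign[of 1] by (simp add: fun_eq_iff on_fields_def g_scale_left g_scale_right orthonormal)
  finally show ?thesis .
qed

text \<open>
  The value of such a \<open>T\<close> depends on \<open>X\<close> only through \<open>X p\<close>, by \<open>tensorial_expansion\<close> below.
\<close>

definition tensorial_at :: "'g \<Rightarrow> ('g vfield \<Rightarrow> 'b::real_vector) \<Rightarrow> bool" where
  "tensorial_at p T \<longleftrightarrow>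
     (\<forall>X Y. smooth_field A X \<longrightarrow> smooth_field A Y \<longrightarrow> T (\<lambda>q. X q + Y q) = T X + T Y) \<and>
     (\<forall>f X. smooth_fun A f \<longrightarrow> smooth_field A X \<longrightarrow> T (\<lambda>q. f q *\<^sub>R X q) = f p *\<^sub>R T X)"

lemma tensorial_atI:
  assumes "\<And>X Y. smooth_field A X \<Longrightarrow> smooth_field A Y \<Longrightarrow> T (\<lambda>q. X q + Y q) = T X + T Y"
    and "\<And>f X. smooth_fun A f \<Longrightarrow> smooth_field A X \<Longrightarrow> T (\<lambda>q. f q *\<^sub>R X q) = f p *\<^sub>R T X"
  shows "tensorial_at p T"
  using assms by (simp add: tensorial_at_def)

lemma
  assumes "tensorial_at p T" "smooth_field A X"
  shows tensorial_add: "smooth_field A Y \<Longrightarrow> T (\<lambda>q. X q + Y q) = T X + T Y"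
    and tensorial_scale: "smooth_fun A f \<Longrightarrow> T (\<lambda>q. f q *\<^sub>R X q) = f p *\<^sub>R T X"
  using assms by (simp_all add: tensorial_at_def)

text \<open>
  The coordinates of a smooth field in the frame are smooth functions, so the field is a combination
  of the frame over smooth functions, to which function-linearity applies term by term.
\<close>

lemma tensorial_expansion:
  assumes T: "tensorial_at p T" and X: "smooth_field A X"
  shows "T X = (\<Sum>i\<in>UNIV. (\<eta> i * g p (X p) (e i p)) *\<^sub>R T (e i))"
proof -
  define f where "f i q = \<eta> i * g q (X q) (e i q)" for i q
  have f: "smooth_fun A (f i)" for i
    using smooth_on_fields[OF X smooth_field_cmult[OF atlas smooth_frame[of i], of "\<eta> i"]]
    by (simp add: on_fields_def[abs_def] f_def[abs_def] g_scale_right)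
  have "T (\<lambda>q. \<Sum>i\<in>I. f i q *\<^sub>R e i q) = (\<Sum>i\<in>I. f i p *\<^sub>R T (e i))" if "finite I" for I
    using that
  proof (induction I)
    case empty
    show ?case
      using tensorial_scale[OF T smooth_frame[of 1] smooth_fun_const[where k = 0]] by simp
  next
    case (insert i I)
    have "smooth_field A (\<lambda>q. f i q *\<^sub>R e i q)" "smooth_field A (\<lambda>q. \<Sum>i\<in>I. f i q *\<^sub>R e i q)"
      by (intro smooth_field_scaleR smooth_field_sum atlas f smooth_frame insert.hyps)+
    then show ?case
      using insert tensorial_add[OF T] tensorial_scale[OF T smooth_frame f] by simp
  qed
  then have "T (\<lambda>q. \<Sum>i\<in>UNIV. f i q *\<^sub>R e i q) = (\<Sum>i\<in>UNIV. f i p *\<^sub>R T (e i))"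
    by simp
  moreover have "X = (\<lambda>q. \<Sum>i\<in>UNIV. f i q *\<^sub>R e i q)"
    unfolding f_def by (rule ext, rule frame_expansion)
  ultimately have "T X = (\<Sum>i\<in>UNIV. f i p *\<^sub>R T (e i))"
    by (rule ssubst[where P = "\<lambda>Y. T Y = _", rotated])
  then show ?thesis by (simp only: f_def)
qed

lemma tensorial_D: "smooth_field A Y \<Longrightarrow> tensorial_at p (\<lambda>X. D X Y p)"
  by (rule tensorial_atI) (simp_all add: D_add_left D_scale_left)

lemma curvature_swap:
  assumes "smooth_field A X" "smooth_field A Z" "smooth_field A Y"
  shows "curvature A D X Z Y p = - curvature A D Z X Y p"
proof -
  have "lie_bracket A X Z = (\<lambda>p. (-1) *\<^sub>R lie_bracket A Z X p)"
    using assms by (simp add: torsion_free)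
  then show ?thesis
    using assms D_cmult_left[OF lie_bracket_smooth[OF assms(2,1)] assms(3), of "-1"]
    by (simp add: curvature_def)
qed

text \<open>
  The derivatives of \<open>f\<close> produced by \<open>\<nabla>\<^sub>X(f \<nabla>\<^sub>ZY)\<close> cancel against those in
  \<open>[X, f Z] = (X f) Z + f [X, Z]\<close>.
\<close>

lemma curvature_tensorial_second:
  assumes "smooth_field A X" "smooth_field A Y"
  shows "tensorial_at p (\<lambda>Z. curvature A D X Z Y p)"
proof (rule tensorial_atI)
  fix Z W assume ZW: "smooth_field A Z" "smooth_field A W"
  have "lie_bracket A X (\<lambda>q. Z q + W q) = (\<lambda>p. lie_bracket A X Z p + lie_bracket A X W p)"
    using assms ZW by (simp add: torsion_free smooth_field_add[OF atlas] D_add_left D_add_right algebra_simps)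
  then show "curvature A D X (\<lambda>q. Z q + W q) Y p = curvature A D X Z Y p + curvature A D X W Y p"
    using assms ZW
    by (simp add: curvature_def D_add_left D_add_right lie_bracket_smooth D_smooth algebra_simps)
next
  fix f Z assume f: "smooth_fun A f" and Z: "smooth_field A Z"
  note Xf = smooth_deriv_along[OF assms(1) f]
  have "lie_bracket A X (\<lambda>q. f q *\<^sub>R Z q) = (\<lambda>p. deriv_along A X f p *\<^sub>R Z p + f p *\<^sub>R lie_bracket A X Z p)"
    using assms f Z
    by (simp add: torsion_free smooth_field_scaleR[OF atlas] D_scale_left D_scale_right algebra_simps)
  then show "curvature A D X (\<lambda>q. f q *\<^sub>R Z q) Y p = f p *\<^sub>R curvature A D X Z Y p"
    using assms f Z Xf
    by (simp add: curvature_def D_add_left D_scale_left D_scale_right lie_bracket_smooth D_smooth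
        smooth_field_scaleR[OF atlas] algebra_simps)
qed

lemma curvature_tensorial_first:
  assumes "smooth_field A Z" "smooth_field A Y"
  shows "tensorial_at p (\<lambda>X. curvature A D X Z Y p)"
  using curvature_tensorial_second[OF assms, of p] curvature_swap[OF _ assms]
  by (simp add: tensorial_at_def smooth_field_add[OF atlas] smooth_field_scaleR[OF atlas])

text \<open>
  Here first derivatives of \<open>f\<close> cancel in pairs and the second-order term
  \<open>[X, Z] f - X (Z f) + Z (X f)\<close> remains, which vanishes by \<open>deriv_along_lie_bracket\<close>.
\<close>

lemma curvature_tensorial_third:
  assumes "smooth_field A X" "smooth_field A Z"
  shows "tensorial_at p (\<lambda>Y. curvature A D X Z Y p)"
proof (rule tensorial_atI)
  fix Y W assume YW: "smooth_field A Y" "smooth_field A W"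
  then show "curvature A D X Z (\<lambda>q. Y q + W q) p = curvature A D X Z Y p + curvature A D X Z W p"
    using assms by (simp add: curvature_def D_add_right lie_bracket_smooth D_smooth algebra_simps)
next
  fix f Y assume f: "smooth_fun A f" and Y: "smooth_field A Y"
  note Xf = smooth_deriv_along[OF assms(1) f]
  note Zf = smooth_deriv_along[OF assms(2) f]
  have comm: "deriv_along A (lie_bracket A X Z) f p
      = deriv_along A X (deriv_along A Z f) p - deriv_along A Z (deriv_along A X f) p"
    by (rule deriv_along_lie_bracket[OF atlas assms f Xf Zf])
  show "curvature A D X Z (\<lambda>q. f q *\<^sub>R Y q) p = f p *\<^sub>R curvature A D X Z Y p"
    using assms f Y Xf Zf
    by (simp add: curvature_def D_add_right D_scale_right lie_bracket_smooth D_smooth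
        smooth_field_scaleR[OF atlas] comm algebra_simps)
qed

section \<open>Ricci, scalar, Schouten and Cotton curvature in the frame\<close>

lemma linear_frame_expansion:
  assumes "linear L"
  shows "L v = (\<Sum>i\<in>UNIV. (\<eta> i * g p v (e i p)) *\<^sub>R L (e i p))"
proof -
  have "L v = L (\<Sum>i\<in>UNIV. (\<eta> i * g p v (e i p)) *\<^sub>R e i p)"
    by (subst frame_expansion[of v p]) (rule refl)
  then show ?thesis
    by (simp add: linear_sum[OF assms] linear_scale[OF assms])
qed

lemma linear_frame_coordinate: "linear (\<lambda>v. \<eta> i * g p v (e i p))"
  by (intro linearI) (simp_all add: g_add_left g_scale_left algebra_simps)

lemma linear_from_frame: "linear (\<lambda>v. \<Sum>i\<in>UNIV. (\<eta> i * g p v (e i p)) *\<^sub>R w i)"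
  by (intro linearI)
    (simp_all add: g_add_left g_scale_left algebra_simps sum.distrib scaleR_sum_right)

text \<open>
  By tensoriality the endomorphism \<open>Z \<mapsto> R(X, Z)Y\<close> exists, and by \<open>frame_expansion\<close> it is determined
  by its values on the frame, so the description in the definition of \<^const>\<open>ricci\<close> denotes it.
\<close>

lemma ricci_in_frame:
  assumes "smooth_field A X" "smooth_field A Y"
  shows "ricci A D X Y p = (\<Sum>i\<in>UNIV. \<eta> i * g p (curvature A D X (e i) Y p) (e i p))"
proof -
  let ?L = "\<lambda>v. \<Sum>i\<in>UNIV. (\<eta> i * g p v (e i p)) *\<^sub>R curvature A D X (e i) Y p"
  have "(THE L. linear L \<and> (\<forall>Z. smooth_field A Z \<longrightarrow> L (Z p) = curvature A D X Z Y p)) = ?L"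
  proof (rule the_equality)
    show "linear ?L \<and> (\<forall>Z. smooth_field A Z \<longrightarrow> ?L (Z p) = curvature A D X Z Y p)"
      using linear_from_frame tensorial_expansion[OF curvature_tensorial_second[OF assms]] by simp
    fix L assume L: "linear L \<and> (\<forall>Z. smooth_field A Z \<longrightarrow> L (Z p) = curvature A D X Z Y p)"
    then have Le: "L (e i p) = curvature A D X (e i) Y p" for i
      using smooth_frame by blast
    show "L = ?L"
    proof
      show "L v = ?L v" for v
        using linear_frame_expansion[of L v p] L unfolding Le by blast
    qed
  qed
  then show ?thesis
    by (simp add: ricci_def trace_finite_rank[OF linear_frame_coordinate])
qed

lemma ricci_tensorial_first:
  assumes "smooth_field A Y"
  shows "tensorial_at p (\<lambda>X. ricci A D X Y p)"
  by (rule tensorial_atI)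
    (simp_all add: ricci_in_frame assms smooth_field_add[OF atlas] smooth_field_scaleR[OF atlas]
      tensorial_add[OF curvature_tensorial_first] tensorial_scale[OF curvature_tensorial_first]
      smooth_frame g_add_left g_scale_left algebra_simps sum.distrib sum_distrib_left)

lemma ricci_tensorial_second:
  assumes "smooth_field A X"
  shows "tensorial_at p (\<lambda>Y. ricci A D X Y p)"
  by (rule tensorial_atI)
    (simp_all add: ricci_in_frame assms smooth_field_add[OF atlas] smooth_field_scaleR[OF atlas]
      tensorial_add[OF curvature_tensorial_third] tensorial_scale[OF curvature_tensorial_third]
      smooth_frame g_add_left g_scale_left algebra_simps sum.distrib sum_distrib_left)

text \<open>
  The Ricci operator sends \<open>e\<^sub>i\<close> to \<open>\<Sum>\<^sub>j \<eta>\<^sub>j \<rho>(e\<^sub>i, e\<^sub>j) e\<^sub>j\<close>.  That this operator represents \<open>\<rho>\<close> on all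
  smooth fields, as its description demands, is the tensoriality of \<open>\<rho>\<close> in both arguments.
\<close>

lemma scalar_curvature_in_frame:
  "scalar_curvature A g D p = (\<Sum>i\<in>UNIV. \<eta> i * ricci A D (e i) (e i) p)"
proof -
  let ?w = "\<lambda>i. \<Sum>j\<in>UNIV. (\<eta> j * ricci A D (e i) (e j) p) *\<^sub>R e j p"
  let ?Q = "\<lambda>v. \<Sum>i\<in>UNIV. (\<eta> i * g p v (e i p)) *\<^sub>R ?w i"
  have "(THE Q. linear Q \<and> (\<forall>X Y. smooth_field A X \<longrightarrow> smooth_field A Y \<longrightarrow>
      g p (Q (X p)) (Y p) = ricci A D X Y p)) = ?Q"
  proof (rule the_equality)
    have "g p (?Q (X p)) (Y p) = ricci A D X Y p" if X: "smooth_field A X" and Y: "smooth_field A Y" for X Y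
    proof -
      have "g p (?w i) (Y p) = ricci A D (e i) Y p" for i
        using tensorial_expansion[OF ricci_tensorial_second[OF smooth_frame[of i]] Y, of p]
        by (simp add: g_sum_left g_scale_left g_sym[of p _ "Y p"] mult_ac)
      then show ?thesis
        using tensorial_expansion[OF ricci_tensorial_first[OF Y] X, of p]
        by (simp add: g_sum_left g_scale_left)
    qed
    then show "linear ?Q \<and> (\<forall>X Y. smooth_field A X \<longrightarrow> smooth_field A Y \<longrightarrow>
        g p (?Q (X p)) (Y p) = ricci A D X Y p)"
      using linear_from_frame[of p ?w] by blast
    fix Q assume Q: "linear Q \<and> (\<forall>X Y. smooth_field A X \<longrightarrow> smooth_field A Y \<longrightarrow>
        g p (Q (X p)) (Y p) = ricci A D X Y p)"
    have w: "Q (e i p) = ?w i" for i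
    proof -
      have "Q (e i p) = (\<Sum>j\<in>UNIV. (\<eta> j * g p (Q (e i p)) (e j p)) *\<^sub>R e j p)"
        by (rule frame_expansion)
      also have "\<dots> = ?w i" using Q smooth_frame by simp
      finally show ?thesis .
    qed
    show "Q = ?Q"
    proof
      show "Q v = ?Q v" for v
        using linear_frame_expansion[of Q v p] Q unfolding w by blast
    qed
  qed
  then show ?thesis
    by (simp only: scalar_curvature_def trace_finite_rank[OF linear_frame_coordinate] frame_coefficient)
qed

lemma
  assumes "smooth_field A Y"
  shows schouten_tensorial_first: "tensorial_at p (\<lambda>X. schouten A g D X Y p)"
    and schouten_tensorial_second: "tensorial_at p (\<lambda>X. schouten A g D Y X p)"
  by (rule tensorial_atI; simp add: schouten_def on_fields_def assms
      tensorial_add[OF ricci_tensorial_first] tensorial_scale[OF ricci_tensorial_first]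
      tensorial_add[OF ricci_tensorial_second] tensorial_scale[OF ricci_tensorial_second]
      g_add_left g_scale_left g_add_right g_scale_right algebra_simps)+

text \<open>
  Torsion-freeness and metric compatibility remove every derivative of \<open>Y\<close> and \<open>Z\<close>, so this form of
  \<open>\<L>\<^sub>Xg\<close> is visibly tensorial in \<open>Y\<close> and \<open>Z\<close>.
\<close>

lemma lie_derivative_metric_eq:
  assumes "smooth_field A X" "smooth_field A Y" "smooth_field A Z"
  shows "lie_derivative_metric A g X Y Z p = g p (D Y X p) (Z p) + g p (D Z X p) (Y p)"
  using assms
  by (simp add: lie_derivative_metric_def metric_compatible torsion_free on_fields_def g_diff_left
      g_sym[of p "Y p"])

lemma
  assumes "smooth_field A X" "smooth_field A Y"
  shows lie_derivative_metric_tensorial_first: "tensorial_at p (\<lambda>Z. lie_derivative_metric A g X Z Y p)"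
    and lie_derivative_metric_tensorial_second: "tensorial_at p (\<lambda>Z. lie_derivative_metric A g X Y Z p)"
  by (rule tensorial_atI; simp add: lie_derivative_metric_eq assms smooth_field_add[OF atlas]
      smooth_field_scaleR[OF atlas] D_add_left D_scale_left
      g_add_left g_scale_left g_add_right g_scale_right algebra_simps)+

lemma D_combination:
  assumes "smooth_field A X"
  shows "D X (\<lambda>p. \<Sum>m\<in>UNIV. a m *\<^sub>R e m p) = (\<lambda>p. \<Sum>m\<in>UNIV. a m *\<^sub>R D X (e m) p)"
proof -
  have "D X (\<lambda>p. \<Sum>m\<in>I. a m *\<^sub>R e m p) = (\<lambda>p. \<Sum>m\<in>I. a m *\<^sub>R D X (e m) p)" if "finite I" for I
    using that
  proof (induction I)
    case empty
    show ?case
      using D_cmult_right[OF assms smooth_frame[of 1], of 0] by simp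
  next
    case (insert i I)
    have "smooth_field A (\<lambda>p. a i *\<^sub>R e i p)" "smooth_field A (\<lambda>p. \<Sum>m\<in>I. a m *\<^sub>R e m p)"
      using smooth_field_cmult[OF atlas smooth_frame]
        smooth_field_sum[OF atlas insert.hyps(1) smooth_fun_const smooth_frame] by auto
    then show ?case
      using insert D_add_right[OF _ _ assms] D_cmult_right[OF assms smooth_frame] by simp
  qed
  then show ?thesis by simp
qed

text \<open>
  In Koszul's formula the derivatives of the inner products drop out, because these are constant on
  the frame.
\<close>

lemma koszul_in_frame:
  "2 * g p (D (e i) (e j) p) (e k p)
    = g p (lie_bracket A (e i) (e j) p) (e k p) - g p (lie_bracket A (e j) (e k) p) (e i p)
    + g p (lie_bracket A (e k) (e i) p) (e j p)"
proof -
  have skew: "g p (D (e a) (e b) p) (e c p) = - g p (D (e a) (e c) p) (e b p)" for a b c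
  proof -
    have "on_fields g (e b) (e c) = (\<lambda>p. if b = c then \<eta> b else 0)"
      by (simp add: fun_eq_iff on_fields_def orthonormal)
    then show ?thesis
      using metric_compatible[OF smooth_frame[of b] smooth_frame[of c] smooth_frame[of a], of p]
      by (simp add: deriv_along_const g_sym[of p "e b p"])
  qed
  show ?thesis
    using skew[of i j k] skew[of j i k] skew[of k i j]
    by (simp add: torsion_free smooth_frame g_diff_left)
qed

text \<open>
  The factor in front only matters through being independent of \<open>i\<close> and \<open>j\<close>.
\<close>

lemma cotton2_of_frame:
  "cotton2 A g D e (e i) (e j) p
    = 1 / (2 * sqrt \<bar>det (\<chi> i j. on_fields g (e i) (e j) p)\<bar>) * \<eta> j *
      (\<Sum>n\<in>UNIV. \<Sum>m\<in>UNIV. cotton3 A g D (e n) (e m) (e i) p * levi_civita_symbol n m j)"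
proof -
  have "(\<Sum>l\<in>UNIV. cotton3 A g D (e n) (e m) (e i) p * levi_civita_symbol n m l * on_fields g (e l) (e j) p)
      = \<eta> j * (cotton3 A g D (e n) (e m) (e i) p * levi_civita_symbol n m j)" for n m
    by (simp add: on_fields_def orthonormal if_distrib[of "\<lambda>x. _ * x"] cong: if_cong)
  then show ?thesis
    by (simp add: cotton2_def sum_distrib_left mult.assoc)
qed

end

section \<open>Frames with constant connection coefficients\<close>

text \<open>
  With constant connection coefficients, as for left-invariant frames, all curvature components are
  constant polynomials in the coefficients.
\<close>

locale constant_frame = orthonormal_frame +
  fixes c :: "3 \<Rightarrow> 3 \<Rightarrow> 3 \<Rightarrow> real"
  assumes D_frame: "D (e i) (e j) = (\<lambda>p. \<Sum>k\<in>UNIV. c i j k *\<^sub>R e k p)"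
begin

text \<open>
  The \<open>l\<close>-th coordinate of \<open>R(e\<^sub>i, e\<^sub>j)e\<^sub>k\<close>; the first summand comes from the derivative along the
  bracket, which has the coordinates \<open>c i j m - c j i m\<close>.
\<close>

definition riemann_coeff :: "3 \<Rightarrow> 3 \<Rightarrow> 3 \<Rightarrow> 3 \<Rightarrow> real" where
  "riemann_coeff i j k l =
     (\<Sum>m\<in>UNIV. (c i j m - c j i m) * c m k l - c j k m * c i m l + c i k m * c j m l)"

definition ricci_coeff :: "3 \<Rightarrow> 3 \<Rightarrow> real" where
  "ricci_coeff i k = (\<Sum>j\<in>UNIV. riemann_coeff i j k j)"

definition schouten_coeff :: "3 \<Rightarrow> 3 \<Rightarrow> real" where
  "schouten_coeff i j = ricci_coeff i j - (\<Sum>k\<in>UNIV. \<eta> k * ricci_coeff k k) / 4 * (if i = j then \<eta> i else 0)"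

lemma combination_swap:
  "(\<Sum>m\<in>UNIV. a m *\<^sub>R (\<Sum>l\<in>UNIV. b m l *\<^sub>R e l p)) = (\<Sum>l\<in>UNIV. (\<Sum>m\<in>UNIV. a m * b m l) *\<^sub>R e l p)"
  unfolding scaleR_sum_right scaleR_sum_left scaleR_scaleR by (rule sum.swap)

lemma curvature_of_frame: "curvature A D (e i) (e j) (e k) p = (\<Sum>l\<in>UNIV. riemann_coeff i j k l *\<^sub>R e l p)"
proof -
  have br: "lie_bracket A (e i) (e j) = (\<lambda>p. \<Sum>m\<in>UNIV. (c i j m - c j i m) *\<^sub>R e m p)"
    by (simp add: torsion_free smooth_frame D_frame scaleR_left_diff_distrib sum_subtractf)
  have 1: "D (lie_bracket A (e i) (e j)) (e k) p
      = (\<Sum>l\<in>UNIV. (\<Sum>m\<in>UNIV. (c i j m - c j i m) * c m k l) *\<^sub>R e l p)"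
    using tensorial_expansion[OF tensorial_D[OF smooth_frame[of k]]
        lie_bracket_smooth[OF smooth_frame[of i] smooth_frame[of j]], of p]
    by (simp add: br frame_coefficient D_frame combination_swap)
  have 2: "D (e a) (D (e b) (e k)) p = (\<Sum>l\<in>UNIV. (\<Sum>m\<in>UNIV. c b k m * c a m l) *\<^sub>R e l p)" for a b
    by (simp add: D_frame[of b k] D_combination smooth_frame D_frame[of a] combination_swap)
  show ?thesis
    by (simp add: curvature_def 1 2 riemann_coeff_def sum.distrib sum_subtractf scaleR_left_diff_distrib
        scaleR_left_distrib)
qed

lemma ricci_of_frame: "ricci A D (e i) (e k) p = ricci_coeff i k"
  by (simp add: ricci_in_frame smooth_frame curvature_of_frame frame_coefficient ricci_coeff_def)

lemma schouten_of_frame: "schouten A g D (e i) (e j) p = schouten_coeff i j"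
  by (simp add: schouten_def scalar_curvature_in_frame ricci_of_frame on_fields_def orthonormal schouten_coeff_def)

lemma covariant_derivative_schouten_of_frame:
  "covariant_derivative A D (e n) (schouten A g D) (e m) (e i) p
    = - (\<Sum>k\<in>UNIV. c n m k * schouten_coeff k i) - (\<Sum>k\<in>UNIV. c n i k * schouten_coeff m k)"
proof -
  have "schouten A g D (e m) (e i) = (\<lambda>p. schouten_coeff m i)"
    by (simp add: fun_eq_iff schouten_of_frame)
  moreover have "schouten A g D (D (e n) (e m)) (e i) p = (\<Sum>k\<in>UNIV. c n m k * schouten_coeff k i)"
    using tensorial_expansion[OF schouten_tensorial_first[OF smooth_frame[of i]]
        D_smooth[OF smooth_frame[of n] smooth_frame[of m]], of p]
    by (simp add: D_frame frame_coefficient schouten_of_frame)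
  moreover have "schouten A g D (e m) (D (e n) (e i)) p = (\<Sum>k\<in>UNIV. c n i k * schouten_coeff m k)"
    using tensorial_expansion[OF schouten_tensorial_second[OF smooth_frame[of m]]
        D_smooth[OF smooth_frame[of n] smooth_frame[of i]], of p]
    by (simp add: D_frame frame_coefficient schouten_of_frame)
  ultimately show ?thesis
    by (simp add: covariant_derivative_def deriv_along_const)
qed

lemma cotton3_of_frame:
  "cotton3 A g D (e n) (e m) (e i) p
    = (\<Sum>k\<in>UNIV. (c m n k - c n m k) * schouten_coeff k i + c m i k * schouten_coeff n k - c n i k * schouten_coeff m k)"
  by (simp add: cotton3_def covariant_derivative_schouten_of_frame sum.distrib sum_subtractf
      left_diff_distrib)

end

section \<open>Unimodular frames and their Cotton solitons\<close>

text \<open>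
  These are the structure constants of a unimodular Lie algebra whose structure operator is diagonal
  in the frame.
\<close>

locale unimodular_frame = orthonormal_frame +
  fixes b :: "3 \<Rightarrow> real"
  assumes bracket_coefficients:
    "g p (lie_bracket A (e i) (e j) p) (e k p) = levi_civita_symbol i j k * b k"
begin

definition \<mu> :: "3 \<Rightarrow> real" where
  "\<mu> i = (\<Sum>j\<in>UNIV. b j) / 2 - b i"

text \<open>
  Koszul's formula contains only cyclic permutations of \<open>\<epsilon>\<^sub>i\<^sub>j\<^sub>k\<close>, so the symbol factors out and
  only half of the signed sum \<open>b\<^sub>k - b\<^sub>i + b\<^sub>j\<close> is left.  For distinct indices this is \<open>\<mu> i\<close>.
\<close>

lemma D_coefficients: "g p (D (e i) (e j) p) (e k p) = levi_civita_symbol i j k * \<mu> i"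
proof -
  have "\<forall>i j k. levi_civita_symbol i j k * b k - levi_civita_symbol j k i * b i + levi_civita_symbol k i j * b j
      = 2 * (levi_civita_symbol i j k * \<mu> i)"
    by (simp add: forall_3 levi_civita_symbol_def \<mu>_def sum_3 field_simps)
  then show ?thesis
    using koszul_in_frame[of p i j k] by (simp add: bracket_coefficients)
qed

definition connection_coeff :: "3 \<Rightarrow> 3 \<Rightarrow> 3 \<Rightarrow> real" where
  "connection_coeff i j k = \<eta> k * (levi_civita_symbol i j k * \<mu> i)"

sublocale constant_frame A g D e \<eta> connection_coeff
proof
  have "D (e i) (e j) p = (\<Sum>k\<in>UNIV. connection_coeff i j k *\<^sub>R e k p)" for i j p
    using frame_expansion[of "D (e i) (e j) p" p] unfolding D_coefficients connection_coeff_def .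
  then show "D (e i) (e j) = (\<lambda>p. \<Sum>k\<in>UNIV. connection_coeff i j k *\<^sub>R e k p)" for i j
    by (rule ext)
qed

lemma ricci_coeff_off_diagonal: "i \<noteq> j \<Longrightarrow> ricci_coeff i j = 0"
proof -
  have "\<forall>i j. i \<noteq> j \<longrightarrow> ricci_coeff i j = 0"
    by (simp add: forall_3 ricci_coeff_def riemann_coeff_def sum_3 connection_coeff_def levi_civita_symbol_def)
  then show "i \<noteq> j \<Longrightarrow> ricci_coeff i j = 0" by blast
qed

lemma schouten_coeff_diagonal: "schouten_coeff i j = (if i = j then schouten_coeff i i else 0)"
  by (simp add: schouten_coeff_def ricci_coeff_off_diagonal)

text \<open>
  As \<open>S\<close> is diagonal, each term of \<open>C\<^sub>n\<^sub>m\<^sub>i\<close> carries a factor \<open>\<epsilon>\<close> with the indices \<open>n, m, i\<close>.  Together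
  with the \<open>\<epsilon>\<^sub>n\<^sub>m\<^sub>j\<close> in the definition of the \<open>(0,2)\<close>-tensor, this forces \<open>i = j\<close>.
\<close>

lemma cotton2_diagonal:
  assumes "i \<noteq> j"
  shows "cotton2 A g D e (e i) (e j) p = 0"
proof -
  have "cotton3 A g D (e n) (e m) (e i) p * levi_civita_symbol n m j = 0" for n m
  proof -
    have "\<forall>n m i j. i \<noteq> j \<longrightarrow> levi_civita_symbol n m j = 0 \<or>
        (levi_civita_symbol n m i = 0 \<and> levi_civita_symbol n i m = 0 \<and>
         levi_civita_symbol m n i = 0 \<and> levi_civita_symbol m i n = 0)"
      by (simp add: forall_3 levi_civita_symbol_def)
    then show ?thesis
      using assms
      by (subst cotton3_of_frame, subst (1 2 3) schouten_coeff_diagonal)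
        (force simp: connection_coeff_def sum.distrib sum_subtractf left_diff_distrib if_distrib[of "\<lambda>x. _ * x"] cong: if_cong)
  qed
  then show ?thesis
    unfolding cotton2_of_frame by (simp only: sum.neutral_const mult_zero_right)
qed

text \<open>
  The trace is a multiple of \<open>\<Sum> \<epsilon>\<^sub>n\<^sub>m\<^sub>i C\<^sub>n\<^sub>m\<^sub>i\<close>, so it antisymmetrises \<open>(\<nabla>\<^sub>nS)\<^sub>m\<^sub>i\<close>, which is
  symmetric in \<open>m\<close> and \<open>i\<close>.
\<close>

lemma cotton2_trace_free: "(\<Sum>i\<in>UNIV. \<eta> i * cotton2 A g D e (e i) (e i) p) = 0"
proof -
  let ?T = "\<lambda>n m i. covariant_derivative A D (e n) (schouten A g D) (e m) (e i) p"
  have sym: "?T n m i = ?T n i m" for n m i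
    unfolding covariant_derivative_schouten_of_frame
    by (subst (1 2 3 4) schouten_coeff_diagonal) (simp add: if_distrib[of "\<lambda>x. _ * x"] cong: if_cong)
  have "(\<Sum>i\<in>UNIV. \<Sum>n\<in>UNIV. \<Sum>m\<in>UNIV. cotton3 A g D (e n) (e m) (e i) p * levi_civita_symbol n m i) = 0"
    using sym[of 1 2 3] sym[of 2 3 1] sym[of 3 1 2]
    by (simp add: cotton3_def sum_3 levi_civita_symbol_def)
  moreover have "\<eta> i * cotton2 A g D e (e i) (e i) p
      = 1 / (2 * sqrt \<bar>det (\<chi> i j. on_fields g (e i) (e j) p)\<bar>) *
        (\<Sum>n\<in>UNIV. \<Sum>m\<in>UNIV. cotton3 A g D (e n) (e m) (e i) p * levi_civita_symbol n m i)" for i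
    using sign[of i] by (simp add: cotton2_of_frame)
  ultimately show ?thesis
    by (simp flip: sum_divide_distrib)
qed

text \<open>
  The entry is \<open>2 g(\<nabla>\<^sub>i X, e\<^sub>i)\<close>, a combination of the coefficients \<open>\<epsilon>\<^sub>i\<^sub>m\<^sub>i\<close>.
\<close>

lemma lie_derivative_diagonal:
  "lie_derivative_metric A g (\<lambda>p. \<Sum>m\<in>UNIV. x m *\<^sub>R e m p) (e i) (e i) p = 0"
proof -
  have X: "smooth_field A (\<lambda>p. \<Sum>m\<in>UNIV. x m *\<^sub>R e m p)"
    using smooth_field_sum[OF atlas finite smooth_fun_const smooth_frame] .
  have "levi_civita_symbol i m i = 0" for m
    by (simp add: levi_civita_symbol_def)
  then show ?thesis
    by (simp add: lie_derivative_metric_eq[OF X smooth_frame smooth_frame] D_combination[OF smooth_frame]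
        g_sum_left g_scale_left D_coefficients)
qed

text \<open>
  The trace of the diagonal equations gives \<open>\<lambda> = 0\<close>.  That \<open>X\<close> is then a Killing field is deduced on
  the frame and extended to all smooth fields by tensoriality of \<open>\<L>\<^sub>Xg\<close>, so the corresponding
  statement about the Cotton tensor need not be proved separately.
\<close>

theorem invariant_soliton_trivial:
  assumes soliton: "cotton_soliton A g D e (\<lambda>p. \<Sum>m\<in>UNIV. x m *\<^sub>R e m p)"
  shows "cotton_trivial A g D e"
proof -
  let ?X = "\<lambda>p. \<Sum>m\<in>UNIV. x m *\<^sub>R e m p"
  from soliton obtain lam where X: "smooth_field A ?X"
    and eq: "\<And>Y Z p. smooth_field A Y \<Longrightarrow> smooth_field A Z \<Longrightarrow>
      lie_derivative_metric A g ?X Y Z p + cotton2 A g D e Y Z p = lam * on_fields g Y Z p"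
    unfolding cotton_soliton_def by blast
  have diag: "\<eta> i * cotton2 A g D e (e i) (e i) p = lam" for i p
    using eq[OF smooth_frame smooth_frame, of i i p] sign[of i]
    by (simp add: lie_derivative_diagonal on_fields_def orthonormal)
  have lam: "lam = 0"
    using cotton2_trace_free by (simp add: diag)
  have killing_frame: "lie_derivative_metric A g ?X (e i) (e j) p = 0" for i j p
    using eq[OF smooth_frame smooth_frame, of i j p] lam
    by (cases "i = j") (simp_all add: lie_derivative_diagonal cotton2_diagonal)
  have "lie_derivative_metric A g ?X Y Z p = 0" if Y: "smooth_field A Y" and Z: "smooth_field A Z" for Y Z p
  proof -
    have "lie_derivative_metric A g ?X (e i) Z p = 0" for i
      using tensorial_expansion[OF lie_derivative_metric_tensorial_second[OF X smooth_frame[of i]] Z, of p]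
      by (simp add: killing_frame)
    then show ?thesis
      using tensorial_expansion[OF lie_derivative_metric_tensorial_first[OF X Z] Y, of p] by simp
  qed
  then show ?thesis
    using eq lam by (simp add: cotton_trivial_def)
qed

end

section \<open>Left-invariant metrics of type Ia\<close>

text \<open>
  Left translation by \<open>p\<close> carries the values of both fields and the metric from the neutral element to
  \<open>p\<close>.
\<close>

lemma left_invariant_on_fields:
  assumes "left_invariant_metric A g" "left_invariant_field A X" "left_invariant_field A Y"
  shows "on_fields g X Y p = on_fields g X Y 0"
proof -
  let ?T = "tangent_map A ((+) p) 0"
  have translate: "Z (p + 0) = ?T (Z 0)" if "left_invariant_field A Z" for Z
    using that unfolding left_invariant_field_def by blast
  have "on_fields g X Y p = g (p + 0) (?T (X 0)) (?T (Y 0))"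
    using translate[OF assms(2)] translate[OF assms(3)] by (simp add: on_fields_def)
  also have "\<dots> = on_fields g X Y 0"
    using assms(1) unfolding left_invariant_metric_def on_fields_def by blast
  finally show ?thesis .
qed

theorem theorem3:
  fixes A :: "'g::{topological_group_add, t2_space, second_countable_topology} chart set"
    and g :: "'g metric_tensor"
    and D :: "'g connection"
    and e :: "3 \<Rightarrow> 'g vfield"
    and \<alpha> \<beta> \<gamma> :: real
  assumes "lie_group A"
    and "connected (UNIV :: 'g set)"
    and "simply_connected (UNIV :: 'g set)"
    and "lorentzian_metric A g"
    and "left_invariant_metric A g"
    and "levi_civita A g D"
    and "type_Ia_basis A g e \<alpha> \<beta> \<gamma>"
    and "\<exists>X. left_invariant_field A X \<and> cotton_soliton A g D e X"
  shows "cotton_trivial A g D e"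
proof -
  have li: "left_invariant_field A (e i)" for i
    using assms(7) by (simp add: type_Ia_basis_def)
  define \<eta> where "\<eta> i = minkowski i i" for i
  interpret orthonormal_frame A g D e \<eta>
  proof
    show "smooth_atlas A" "pseudo_riemannian_metric A g" "levi_civita A g D"
      using assms by (simp_all add: lie_group_def lorentzian_metric_def)
    show "smooth_field A (e i)" for i
      using li by (simp add: left_invariant_field_def)
    show "g p (e i p) (e j p) = (if i = j then \<eta> i else 0)" for p i j
    proof -
      have "g p (e i p) (e j p) = minkowski i j"
        using assms(7) unfolding type_Ia_basis_def on_fields_def by blast
      then show ?thesis by (simp add: minkowski_def \<eta>_def)
    qed
    show "\<eta> i * \<eta> i = 1" for i
      by (simp add: \<eta>_def minkowski_def)
  qed
  \<comment> \<open>For instance \<open>g([e\<^sub>1, e\<^sub>2], e\<^sub>3) = - \<gamma> \<eta>\<^sub>3 = \<gamma>\<close>: the timelike \<open>e\<^sub>3\<close> absorbs the sign.\<close>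
  define b :: "3 \<Rightarrow> real" where "b k = (if k = 1 then \<alpha> else if k = 2 then \<beta> else \<gamma>)" for k
  interpret unimodular_frame A g D e \<eta> b
  proof
    fix p i j k
    have "lie_bracket A (e 1) (e 2) p = - \<gamma> *\<^sub>R e 3 p" "lie_bracket A (e 1) (e 3) p = - \<beta> *\<^sub>R e 2 p"
      "lie_bracket A (e 2) (e 3) p = \<alpha> *\<^sub>R e 1 p"
      using assms(7) by (simp_all add: type_Ia_basis_def)
    moreover have "lie_bracket A (e i) (e j) p = - lie_bracket A (e j) (e i) p" for i j
      by (simp add: torsion_free smooth_frame)
    moreover have "lie_bracket A (e i) (e i) p = 0" for i
      by (simp add: torsion_free smooth_frame)
    ultimately have br: "lie_bracket A (e 1) (e 2) p = (- \<gamma>) *\<^sub>R e 3 p" "lie_bracket A (e 1) (e 3) p = (- \<beta>) *\<^sub>R e 2 p"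
      "lie_bracket A (e 2) (e 3) p = \<alpha> *\<^sub>R e 1 p" "lie_bracket A (e 2) (e 1) p = \<gamma> *\<^sub>R e 3 p"
      "lie_bracket A (e 3) (e 1) p = \<beta> *\<^sub>R e 2 p" "lie_bracket A (e 3) (e 2) p = (- \<alpha>) *\<^sub>R e 1 p"
      "lie_bracket A (e 1) (e 1) p = 0 *\<^sub>R e 1 p" "lie_bracket A (e 2) (e 2) p = 0 *\<^sub>R e 1 p" "lie_bracket A (e 3) (e 3) p = 0 *\<^sub>R e 1 p"
      by (metis minus_minus scaleR_minus_left scaleR_zero_left)+
    have "\<forall>i j k. g p (lie_bracket A (e i) (e j) p) (e k p) = levi_civita_symbol i j k * b k"
      by (simp add: forall_3 br g_scale_left orthonormal levi_civita_symbol_def b_def \<eta>_def minkowski_def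
          del: scaleR_zero_left scaleR_minus_left)
    then show "g p (lie_bracket A (e i) (e j) p) (e k p) = levi_civita_symbol i j k * b k"
      by blast
  qed
  obtain X where X: "left_invariant_field A X" "cotton_soliton A g D e X"
    using assms(8) by blast
  define x where "x i = \<eta> i * on_fields g X (e i) 0" for i
  have const: "\<eta> i * g p (X p) (e i p) = x i" for p i
    using left_invariant_on_fields[OF assms(5) X(1) li, of i p] by (simp add: on_fields_def x_def)
  have "X p = (\<Sum>i\<in>UNIV. x i *\<^sub>R e i p)" for p
    using frame_expansion[of "X p" p] unfolding const .
  then have "X = (\<lambda>p. \<Sum>i\<in>UNIV. x i *\<^sub>R e i p)"
    by (rule ext)
  then show ?thesis
    using invariant_soliton_trivial[of x] X(2) by simp
qed

end
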